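(* Let $S\subset\mathbb{R}^2$ be the Sierpinski gasket, $s=\frac{\log 3}{\log 2}$, and let $C^s(S)$ be the centred Hausdorff $s$-dimensional measure of $S$. With $A_k$ and $\mu_k$ the discrete approximations of $S$ and of its invariant measure, and $S_{01}=f_0(f_1(S))$, let, for integers $k\ge4$, $$C_{k}=\min \left\{ (\theta _{\mu _{k}}^{s}(x,d))^{-1}:\ x\in A_{k}\cap S_{01},\ d=|y-x| \text{ with } y\in A_{k},\ \text{and } \frac{\sqrt{3}}{16}\leq d\leq \frac{\sqrt{3}}{8}+2^{1-k}\right\},$$ where $\theta_{\mu_k}^s(x,d)=\dfrac{\mu_k(B(x,d))}{(2d)^s}$. Then $C_k$ converges to $C^s(S)$ as $k\to\infty$.
   Context: Let $M=\{0,1,2\}$ and let $f_i:\mathbb{R}^2\to\mathbb{R}^2$, $f_i(x)=\frac12 x+v_i$, $i\in M$, with $v_0=(0,0)$, $v_1=(\frac12,0)$, $v_2=\frac14(1,\sqrt3)$. The Sierpinski gasket $S$ is the unique non-empty compact set with $S=f_0(S)\cup f_1(S)\cup f_2(S)$. For a word $i=i_1\dots i_k\in M^k$, $f_i:=f_{i_1}\circ\dots\circ f_{i_k}$ and $S_i:=f_i(S)$ (for the empty word, $f_i$ is the identity). $z_i=2v_i$ is the fixed point of $f_i$, $i\in M$. Discrete approximations: $A_1:=\{z_0,z_1,z_2\}$ and $A_k:=F^{k-1}(A_1)$ for $k\ge2$, where $F(A)=f_0(A)\cup f_1(A)\cup f_2(A)$; and $$\mu_k:=\frac1{3^k}\sum_{i\in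 M^{k-1}}\left(\delta_{f_i(z_0)}+\delta_{f_i(z_1)}+\delta_{f_i(z_2)}\right),$$ where $\delta_x$ is the Dirac probability measure at $x$; equivalently $\mu_k=\frac{1}{3^k}(\delta_{z_0}+\delta_{z_1}+\delta_{z_2})+\frac{2}{3^k}\sum_{x\in A_k\setminus A_1}\delta_x$. $B(x,d)$ is the closed Euclidean ball with centre $x$ and radius $d$. Centred Hausdorff measure: for $A\subset\mathbb{R}^n$ put $$C_0^s(A)=\lim_{\delta\to0}\inf\Big\{\sum_{i=1}^\infty(2d_i)^s:\ 2d_i\le\delta,\ i=1,2,\dots\Big\},$$ the infimum being over all countable coverings $\{B(x_i,d_i)\}$ of $A$ by closed balls with centres $x_i\in A$ (with $C_0^s(\varnothing)=0$), and $$C^s(A)=\sup\{C_0^s(F):F\subset A,\ F\text{ closed}\}.$$ *)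

theory Defs
  imports "HOL-Probability.Probability"
begin

definition alphabet :: "nat set" where
  "alphabet = {0, 1, 2}"

definition shift :: "nat \<Rightarrow> real^2" where
  "shift i = (if i = 0 then vector [0, 0]
          else if i = 1 then vector [1/2, 0]
          else (1/4) *\<^sub>R vector [1, sqrt 3])"

definition smap :: "nat \<Rightarrow> real^2 \<Rightarrow> real^2" where
  "smap i x = (1/2) *\<^sub>R x + shift i"

definition corner :: "nat \<Rightarrow> real^2" where
  "corner i = 2 *\<^sub>R shift i"

definition words :: "nat \<Rightarrow> nat list set" where
  "words n = {w. set w \<subseteq> alphabet \<and> length w = n}"

definition smap_word :: "nat list \<Rightarrow> real^2 \<Rightarrow> real^2" where
  "smap_word w = foldr (\<lambda>i g. smap i \<circ> g) w id"

definition gasket_step :: "(real^2) set \<Rightarrow> (real^2) set" where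
  "gasket_step B = smap 0 ` B \<union> smap 1 ` B \<union> smap 2 ` B"

definition gasket :: "(real^2) set" where
  "gasket = (THE S. S \<noteq> {} \<and> compact S \<and> S = gasket_step S)"

definition cell :: "nat list \<Rightarrow> (real^2) set" where
  "cell w = smap_word w ` gasket"

text \<open>The sets \<open>A_approx k\<close> and the measures \<open>mu k\<close> are meaningful for \<open>k \<ge> 1\<close> only.\<close>

definition A_approx :: "nat \<Rightarrow> (real^2) set" where
  "A_approx k = (gasket_step ^^ (k - 1)) {corner 0, corner 1, corner 2}"

text \<open>\<open>return borel x\<close> is the Dirac measure at \<open>x\<close>.  That the set function below is
  countably additive, so that \<open>measure_of\<close> does not collapse to the null measure, is
  \<open>emeasure_mu\<close>.\<close>

definition mu_fun :: "nat \<Rightarrow> (real^2) set \<Rightarrow> ennreal" where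
  "mu_fun k B = (1 / 3 ^ k) * (\<Sum>w\<in>words (k - 1).
       emeasure (return borel (smap_word w (corner 0))) B
     + emeasure (return borel (smap_word w (corner 1))) B
     + emeasure (return borel (smap_word w (corner 2))) B)"

definition mu :: "nat \<Rightarrow> (real^2) measure" where
  "mu k = measure_of UNIV (sets borel) (mu_fun k)"

lemma sets_mu [simp]: "sets (mu k) = sets borel"
  unfolding mu_def using sets.sigma_sets_eq[of "borel :: (real^2) measure"]
  by (simp add: sets_measure_of_conv)

lemma space_mu [simp]: "space (mu k) = UNIV"
  unfolding mu_def by (simp add: space_measure_of_conv)

lemma emeasure_mu:
  assumes "B \<in> sets borel"
  shows "emeasure (mu k) B = mu_fun k B"
proof (rule emeasure_measure_of[OF mu_def])
  show "positive (sets (mu k)) (mu_fun k)"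
    by (simp add: positive_def mu_fun_def)
  show "countably_additive (sets (mu k)) (mu_fun k)"
  proof (rule countably_additiveI)
    fix X :: "nat \<Rightarrow> (real^2) set"
    assume X: "range X \<subseteq> sets (mu k)" and d: "disjoint_family X"
    have e: "emeasure (return borel x) (\<Union>i. X i) = (\<Sum>i. emeasure (return borel x) (X i))"
      for x :: "real^2"
      by (rule suminf_emeasure[symmetric]) (use X d in auto)
    show "(\<Sum>i. mu_fun k (X i)) = mu_fun k (\<Union>i. X i)"
      unfolding mu_fun_def e by (simp add: suminf_sum suminf_add)
  qed
qed (use assms in \<open>auto\<close>)

definition theta :: "(real^2) measure \<Rightarrow> real \<Rightarrow> real^2 \<Rightarrow> real \<Rightarrow> real" where
  "theta m s x d = measure m (cball x d) / (2 * d) powr s"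

text \<open>Coverings are indexed by all of \<open>nat\<close>, with positive radii.  For \<open>s > 0\<close> a finite covering
  can be padded by balls whose contribution to the sum is arbitrarily small, so finite coverings
  and degenerate balls do not change the infimum.\<close>

definition centred_premeasure_at ::
    "real \<Rightarrow> real \<Rightarrow> 'a::euclidean_space set \<Rightarrow> ennreal" where
  "centred_premeasure_at s \<delta> E =
     Inf {(\<Sum>i. ennreal ((2 * d i) powr s)) | (x :: nat \<Rightarrow> 'a) (d :: nat \<Rightarrow> real).
            (\<forall>i. x i \<in> E \<and> 0 < d i \<and> 2 * d i \<le> \<delta>) \<and> E \<subseteq> (\<Union>i. cball (x i) (d i))}"

lemma centred_premeasure_at_antimono:
  fixes E :: "'a::euclidean_space set"
  assumes "\<delta> \<le> \<delta>'"
  shows "centred_premeasure_at s \<delta>' E \<le> centred_premeasure_at s \<delta> E"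
  unfolding centred_premeasure_at_def
proof (rule Inf_superset_mono, rule subsetI)
  fix c
  assume "c \<in> {(\<Sum>i. ennreal ((2 * d i) powr s)) | (x :: nat \<Rightarrow> 'a) (d :: nat \<Rightarrow> real).
            (\<forall>i. x i \<in> E \<and> 0 < d i \<and> 2 * d i \<le> \<delta>) \<and> E \<subseteq> (\<Union>i. cball (x i) (d i))}"
  then obtain x d where c: "c = (\<Sum>i. ennreal ((2 * d i) powr s))"
    "\<forall>i. x i \<in> E \<and> 0 < d i \<and> 2 * d i \<le> \<delta>" "E \<subseteq> (\<Union>i. cball (x i) (d i))"
    by blast
  have "\<forall>i. x i \<in> E \<and> 0 < d i \<and> 2 * d i \<le> \<delta>'"
    using c(2) assms by (meson order_trans)
  then show "c \<in> {(\<Sum>i. ennreal ((2 * d i) powr s)) | (x :: nat \<Rightarrow> 'a) (d :: nat \<Rightarrow> real).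
            (\<forall>i. x i \<in> E \<and> 0 < d i \<and> 2 * d i \<le> \<delta>') \<and> E \<subseteq> (\<Union>i. cball (x i) (d i))}"
    using c(1,3) by (intro CollectI exI[of _ x] exI[of _ d] conjI)
qed

text \<open>The limit exists by monotonicity in \<open>\<delta>\<close>, see \<open>centred_premeasure_at_tendsto\<close>.\<close>

definition centred_premeasure :: "real \<Rightarrow> 'a::euclidean_space set \<Rightarrow> ennreal" where
  "centred_premeasure s E =
     (if E = {} then 0 else Lim (at_right 0) (\<lambda>\<delta>. centred_premeasure_at s \<delta> E))"

lemma centred_premeasure_at_tendsto:
  assumes "E \<noteq> {}"
  shows "((\<lambda>\<delta>. centred_premeasure_at s \<delta> E) \<longlongrightarrow> centred_premeasure s E) (at_right 0)"
proof -
  let ?g = "\<lambda>\<delta>. centred_premeasure_at s \<delta> E"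
  have "(?g \<longlongrightarrow> (SUP \<delta>\<in>{0<..}. ?g \<delta>)) (at_right 0)"
  proof (rule order_tendstoI)
    fix a assume "a < (SUP \<delta>\<in>{0<..}. ?g \<delta>)"
    then obtain e where e: "e > 0" "a < ?g e"
      by (auto simp: less_SUP_iff)
    have "a < ?g \<delta>" if "\<delta> < e" for \<delta>
      using e(2) centred_premeasure_at_antimono[of \<delta> e s E] that by (simp add: less_le_trans)
    then show "\<forall>\<^sub>F \<delta> in at_right 0. a < ?g \<delta>"
      unfolding eventually_at_right_field using e(1) by (intro exI[of _ e]) simp
  next
    fix a assume "(SUP \<delta>\<in>{0<..}. ?g \<delta>) < a"
    then have "?g \<delta> < a" if "0 < \<delta>" for \<delta>
      using that by (intro le_less_trans[OF SUP_upper[of \<delta> "{0<..}" ?g]]) simp_all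
    then show "\<forall>\<^sub>F \<delta> in at_right 0. ?g \<delta> < a"
      unfolding eventually_at_right_field by (intro exI[of _ 1]) simp
  qed
  then show ?thesis
    using assms by (simp add: centred_premeasure_def tendsto_Lim)
qed

definition centred_Hausdorff :: "real \<Rightarrow> 'a::euclidean_space set \<Rightarrow> ennreal" where
  "centred_Hausdorff s E = Sup {centred_premeasure s G | G. G \<subseteq> E \<and> closed G}"

definition dim_S :: real where
  "dim_S = ln 3 / ln 2"

text \<open>Used for \<open>k \<ge> 4\<close> only; then the minimum is over a finite non-empty set.\<close>

definition C_approx :: "nat \<Rightarrow> real" where
  "C_approx k = Min {inverse (theta (mu k) dim_S x d) | x d.
                x \<in> A_approx k \<inter> cell [0, 1] \<and> (\<exists>y\<in>A_approx k. d = norm (y - x)) \<and>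
                sqrt 3 / 16 \<le> d \<and> d \<le> sqrt 3 / 8 + 2 powr (1 - real k)}"

end

theory Submission
  imports Defs
begin

text \<open>Let \<open>M\<close> be the self-similar probability measure on the gasket \<open>S\<close>, and put
  \<open>q(x, d) = (2d)^s / M(B(x, d))\<close>.

  For every \<open>x \<in> S\<close> and \<open>d > 0\<close> we have \<open>C^s(S) \<le> q(x, d)\<close>: apart from points whose coding avoids a
  fixed word (these are covered by \<open>(3^L - 1)^n\<close> cells of level about \<open>n L\<close>, at vanishing cost), every
  point of \<open>S\<close> has arbitrarily small balls that contain a scaled copy of \<open>B(x, d)\<close> and are
  only marginally larger, and a Vitali selection makes such balls disjoint.

  Conversely \<open>C^s(S) \<ge> inf q(x, d)\<close> over \<open>x \<in> S_01\<close> and \<open>sqrt 3 / 16 \<le> d < sqrt 3 / 8\<close>: a small ball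
  centred in a cell, of radius less than the height of that cell, meets only the cells touching it.
  By a parity argument on their integer addresses these form, up to a symmetry of \<open>S\<close>, part of the
  configuration \<open>S_00, S_01, S_02, S_10\<close>, so the ball is dominated by one centred in \<open>S_01\<close>.

  One atom of \<open>mu k\<close> sits in each level-\<open>k\<close> cell, so \<open>M\<close> and \<open>mu k\<close> agree on balls up to
  changing the radius by \<open>2^-k\<close>.  Hence \<open>C_approx\<close> is asymptotically squeezed between the infimum of
  \<open>q\<close> over all balls and the infimum over the restricted range, both equal to \<open>C^s(S)\<close>.\<close>

section \<open>Barycentric coordinates and words\<close>

text \<open>Coordinates with respect to the three corners. In them \<open>smap i\<close> halves
  every entry and adds 1/2 to entry \<open>i\<close>, which reduces later arguments to binary
  arithmetic.\<close>

definition bary :: "nat \<Rightarrow> real^2 \<Rightarrow> real" where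
  "bary a x = (if a = 0 then 1 - x$1 - x$2 / sqrt 3 else if a = 1 then x$1 - x$2 / sqrt 3
     else 2 * x$2 / sqrt 3)"

lemma finite_alphabet [simp]: "finite alphabet"
  by (simp add: alphabet_def)

lemma sum_alphabet: "(\<Sum>a\<in>alphabet. g a) = g 0 + g 1 + (g 2 :: 'a::comm_monoid_add)"
  by (simp add: alphabet_def add.assoc)

lemma ball_alphabet: "(\<forall>a\<in>alphabet. P a) \<longleftrightarrow> P 0 \<and> P 1 \<and> P 2"
  by (auto simp: alphabet_def)

lemma UN_alphabet: "(\<Union>a\<in>alphabet. P a) = P 0 \<union> P 1 \<union> P 2"
  by (auto simp: alphabet_def)

lemma in_alphabet [simp]: "0 \<in> alphabet" "Suc 0 \<in> alphabet" "1 \<in> alphabet" "2 \<in> alphabet"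
  by (auto simp: alphabet_def)

lemma bary_smap:
  assumes "a \<in> alphabet" "i \<in> alphabet"
  shows "bary a (smap i x) = (bary a x + of_bool (i = a)) / 2"
  using assms
  by (auto simp: alphabet_def bary_def smap_def shift_def field_simps)

lemma bary_corner:
  assumes "a \<in> alphabet" "i \<in> alphabet"
  shows "bary a (corner i) = of_bool (i = a)"
  using assms
  by (auto simp: alphabet_def bary_def corner_def shift_def field_simps)

lemma sum_bary: "(\<Sum>a\<in>alphabet. bary a x) = 1"
  by (simp add: sum_alphabet bary_def field_simps)

text \<open>The corners form an equilateral triangle of side 1. The right-hand side is symmetric in
  the coordinates, so permuting them preserves distances.\<close>

lemma dist_bary: "(dist x y)\<^sup>2 = (\<Sum>a\<in>alphabet. (bary a x - bary a y)\<^sup>2) / 2"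
proof -
  define p where "p = x$1 - y$1"
  define q where "q = (x$2 - y$2) / sqrt 3"
  have b: "bary 0 x - bary 0 y = - p - q" "bary 1 x - bary 1 y = p - q"
    "bary 2 x - bary 2 y = 2 * q"
    by (simp_all add: bary_def p_def q_def diff_divide_distrib algebra_simps)
  have q: "x$2 - y$2 = sqrt 3 * q"
    by (simp add: q_def)
  have "(dist x y)\<^sup>2 = p\<^sup>2 + (x$2 - y$2)\<^sup>2"
    by (simp add: dist_vec_def L2_set_def sum_2 dist_real_def p_def)
  also have "\<dots> = p\<^sup>2 + 3 * q\<^sup>2"
    unfolding q by (simp add: power_mult_distrib)
  also have "\<dots> = (\<Sum>a\<in>alphabet. (bary a x - bary a y)\<^sup>2) / 2"
    unfolding sum_alphabet b by (simp add: power2_eq_square algebra_simps)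
  finally show ?thesis .
qed

lemma bary_eqI:
  assumes "\<And>a. a \<in> alphabet \<Longrightarrow> bary a x = bary a y"
  shows "x = y"
  using dist_bary[of x y] assms by simp

text \<open>The constant is the reciprocal of the height \<open>sqrt 3 / 2\<close> of the triangle,
  along which a coordinate runs from 0 to 1. As the three differences sum to 0, three times the
  square of one is at most twice the sum of all squares.\<close>

lemma bary_diff_le:
  assumes "a \<in> alphabet"
  shows "\<bar>bary a x - bary a y\<bar> \<le> 2 / sqrt 3 * dist x y"
proof -
  define g where "g a = bary a x - bary a y" for a
  have s: "g 0 + g 1 + g 2 = 0"
    using sum_bary[of x] sum_bary[of y] by (simp add: sum_alphabet g_def)
  have "3 * (g a)\<^sup>2 \<le> 4 * (dist x y)\<^sup>2"
  proof -
    have *: "3 * u\<^sup>2 \<le> 2 * (u\<^sup>2 + v\<^sup>2 + w\<^sup>2)" if "u + v + w = 0" for u v w :: real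
    proof -
      have u: "u = - v - w" using that by simp
      have "2 * (u\<^sup>2 + v\<^sup>2 + w\<^sup>2) - 3 * u\<^sup>2 = (v - w)\<^sup>2"
        unfolding u by (simp add: power2_eq_square algebra_simps)
      then show ?thesis using zero_le_power2[of "v - w"] by linarith
    qed
    show ?thesis
      using assms s *[of "g 0" "g 1" "g 2"] *[of "g 1" "g 0" "g 2"] *[of "g 2" "g 0" "g 1"]
      unfolding dist_bary g_def[symmetric] sum_alphabet
      by (auto simp: alphabet_def)
  qed
  then have "(g a)\<^sup>2 \<le> (2 / sqrt 3 * dist x y)\<^sup>2"
    by (simp add: power_mult_distrib power_divide)
  then show ?thesis
    unfolding g_def by (metis abs_le_square_iff abs_of_nonneg mult_nonneg_nonneg divide_nonneg_nonneg
      real_sqrt_ge_zero zero_le_dist zero_le_numeral)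
qed

lemma continuous_on_bary [continuous_intros]:
  "continuous_on A g \<Longrightarrow> continuous_on A (\<lambda>x. bary a (g x))"
  unfolding bary_def by (cases "a = 0"; cases "a = 1") (auto intro!: continuous_intros)

lemma dist_smap: "dist (smap i x) (smap i y) = dist x y / 2"
  by (simp add: smap_def dist_norm scaleR_diff_right[symmetric])

lemma smap_word_Nil [simp]: "smap_word [] = id"
  by (simp add: smap_word_def)

lemma smap_word_Cons [simp]: "smap_word (i # w) = smap i \<circ> smap_word w"
  by (simp add: smap_word_def)

lemma smap_word_append: "smap_word (u @ w) = smap_word u \<circ> smap_word w"
  by (induction u) (auto simp: comp_assoc)

lemma dist_smap_word: "dist (smap_word w x) (smap_word w y) = dist x y / 2 ^ length w"
  by (induction w) (auto simp: dist_smap field_simps)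

lemma continuous_on_smap [continuous_intros]:
  "continuous_on A g \<Longrightarrow> continuous_on A (\<lambda>x. smap i (g x))"
  unfolding smap_def by (intro continuous_intros)

lemma continuous_on_smap_word [continuous_intros]:
  "continuous_on A g \<Longrightarrow> continuous_on A (\<lambda>x. smap_word w (g x))"
  by (induction w) (auto intro: continuous_intros)

lemma corner_fixed: "smap i (corner i) = corner i"
  by (simp add: smap_def corner_def scaleR_2)

lemma smap_corner_commute: "smap i (corner j) = smap j (corner i)"
  by (simp add: smap_def corner_def add.commute)

lemma words_0 [simp]: "words 0 = {[]}"
  by (auto simp: words_def)

lemma finite_words [simp]: "finite (words k)"
  unfolding words_def using finite_lists_length_eq[OF finite_alphabet] by simp

lemma card_words: "card (words k) = 3 ^ k"
  unfolding words_def by (subst card_lists_length_eq) (auto simp: alphabet_def eval_nat_numeral)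

lemma words_append: "u \<in> words m \<Longrightarrow> w \<in> words n \<Longrightarrow> u @ w \<in> words (m + n)"
  by (auto simp: words_def)

lemma words_Suc: "words (Suc k) = (\<lambda>(i, w). i # w) ` (alphabet \<times> words k)"
  by (auto simp: words_def length_Suc_conv image_iff)

lemma words_snoc: "words (Suc k) = (\<lambda>(w, i). w @ [i]) ` (words k \<times> alphabet)"
proof -
  have "\<exists>u i. w = u @ [i] \<and> u \<in> words k \<and> i \<in> alphabet" if "w \<in> words (Suc k)" for w
    using that by (cases w rule: rev_cases) (auto simp: words_def)
  then show ?thesis
    by (fastforce simp: words_def)
qed

lemma length_words: "w \<in> words k \<Longrightarrow> length w = k"
  by (simp add: words_def)

lemma sum_words_Suc:
  "(\<Sum>w\<in>words (Suc k). g w) = (\<Sum>i\<in>alphabet. \<Sum>w\<in>words k. (g (i # w) :: 'a::comm_monoid_add))"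
  unfolding words_Suc sum.cartesian_product
  by (subst sum.reindex) (auto simp: inj_on_def intro!: sum.cong)

lemma sum_words_snoc:
  "(\<Sum>w\<in>words (Suc k). g w) = (\<Sum>w\<in>words k. \<Sum>i\<in>alphabet. (g (w @ [i]) :: 'a::comm_monoid_add))"
  unfolding words_snoc sum.cartesian_product
  by (subst sum.reindex) (auto simp: inj_on_def intro!: sum.cong)

lemma UN_gasket_step: "gasket_step B = (\<Union>i\<in>alphabet. smap i ` B)"
  by (simp add: gasket_step_def UN_alphabet)

section \<open>The gasket\<close>

lemma invariant_words:
  assumes "B = gasket_step B"
  shows "B = (\<Union>w\<in>words k. smap_word w ` B)"
proof (induction k)
  case (Suc k)
  have "B = (\<Union>i\<in>alphabet. smap i ` B)" using assms by (simp add: UN_gasket_step)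
  also have "\<dots> = (\<Union>i\<in>alphabet. smap i ` (\<Union>w\<in>words k. smap_word w ` B))"
    using Suc by simp
  also have "\<dots> = (\<Union>w\<in>words (Suc k). smap_word w ` B)"
    unfolding words_Suc by (force simp: image_UN image_comp)
  finally show ?case .
qed simp

text \<open>Trace a point of \<open>A\<close> back through \<open>n\<close> maps and run the same
  maps forwards from a point of \<open>B\<close>: the result lies in \<open>B\<close>, within
  \<open>M / 2 ^ n\<close> of the given point. This yields uniqueness of the gasket and places coded
  points in it.\<close>

lemma invariant_subset:
  assumes A: "bounded A" "A \<subseteq> gasket_step A"
    and B: "B \<noteq> {}" "compact B" "gasket_step B \<subseteq> B"
  shows "A \<subseteq> B"
proof
  fix a assume "a \<in> A"
  obtain b where b: "b \<in> B" using B by auto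
  have "bounded (A \<union> {b})" using A by simp
  then obtain M where M: "\<And>x y. x \<in> A \<union> {b} \<Longrightarrow> y \<in> A \<union> {b} \<Longrightarrow> dist x y \<le> M"
    unfolding bounded_two_points by blast
  have inB: "smap_word w b \<in> B" if "set w \<subseteq> alphabet" for w
    using that
  proof (induction w)
    case (Cons i w)
    then have "smap i (smap_word w b) \<in> gasket_step B"
      unfolding UN_gasket_step by auto
    then show ?case using B by auto
  qed (simp add: b)
  have ex: "\<exists>w\<in>words k. \<exists>a'\<in>A. a = smap_word w a'" if "a \<in> A" for a k
    using that
  proof (induction k arbitrary: a)
    case (Suc k)
    from Suc.prems A obtain i a1 where i: "i \<in> alphabet" "a1 \<in> A" "a = smap i a1"
      unfolding UN_gasket_step by blast
    then obtain w a' where "w \<in> words k" "a' \<in> A" "a1 = smap_word w a'"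
      using Suc.IH by blast
    then show ?case using i unfolding words_Suc by (intro bexI[of _ "i # w"]) auto
  qed auto
  have "\<exists>y\<in>B. dist y a < e" if "e > 0" for e
  proof -
    obtain n where n: "M / e < 2 ^ n"
      using real_arch_pow[of 2 "M / e"] by auto
    obtain w a' where w: "w \<in> words n" "a' \<in> A" "a = smap_word w a'"
      using ex[OF \<open>a \<in> A\<close>] by blast
    have "dist (smap_word w b) a = dist b a' / 2 ^ n"
      using w by (simp add: dist_smap_word length_words)
    also have "\<dots> \<le> M / 2 ^ n" using M w by (intro divide_right_mono) auto
    also have "\<dots> < e" using n that by (simp add: field_simps)
    finally show ?thesis using inB w by (auto simp: words_def)
  qed
  then have "a \<in> closure B" by (simp add: closure_approachable)
  then show "a \<in> B" using B by (simp add: compact_imp_closed closure_closed)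
qed

lemma gasket_step_mono: "A \<subseteq> B \<Longrightarrow> gasket_step A \<subseteq> gasket_step B"
  unfolding gasket_step_def by auto

text \<open>The corners are fixed points, so their iterated images increase. The union is invariant,
  and bounded because coordinates stay in [0, 1]; its closure is the set sought.\<close>

lemma gasket_exists: "\<exists>S. S \<noteq> {} \<and> compact S \<and> S = gasket_step S"
proof -
  define A where "A k = (gasket_step ^^ k) (corner ` alphabet)" for k
  have ASuc: "A (Suc k) = gasket_step (A k)" for k by (simp add: A_def)
  have A01: "A k \<subseteq> A (Suc k)" for k
  proof (induction k)
    case 0
    have "corner i \<in> gasket_step (corner ` alphabet)" if "i \<in> alphabet" for i
      using that corner_fixed[of i] unfolding UN_gasket_step by force
    then show ?case by (auto simp: A_def)
  next
    case (Suc k)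
    then show ?case using gasket_step_mono ASuc by metis
  qed
  define U where "U = (\<Union>k. A k)"
  have U: "gasket_step U = U"
  proof -
    have "gasket_step U = (\<Union>k. gasket_step (A k))"
      unfolding U_def gasket_step_def by blast
    also have "\<dots> = (\<Union>k. A (Suc k))" by (simp add: ASuc)
    also have "\<dots> = U" unfolding U_def using A01 by blast
    finally show ?thesis .
  qed
  have range: "bary a x \<in> {0..1}" if "x \<in> A k" "a \<in> alphabet" for a k x
    using that
  proof (induction k arbitrary: x)
    case 0
    then show ?case by (auto simp: A_def bary_corner)
  next
    case (Suc k)
    then obtain i y where "i \<in> alphabet" "y \<in> A k" "x = smap i y"
      unfolding ASuc UN_gasket_step by auto
    with Suc.IH[of y] Suc.prems show ?case by (auto simp: bary_smap field_simps of_bool_def)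
  qed
  have "dist x (corner 0) \<le> 2" if "x \<in> U" for x
  proof -
    have "(dist x (corner 0))\<^sup>2 \<le> 2\<^sup>2"
    proof -
      have "(bary a x - bary a (corner 0))\<^sup>2 \<le> 1" if "a \<in> alphabet" for a
        using range[of x _ a] \<open>x \<in> U\<close> that bary_corner[of a 0]
        by (auto simp: U_def abs_square_le_1)
      from this[of 0] this[of 1] this[of 2] show ?thesis
        unfolding dist_bary sum_alphabet by simp
    qed
    then show ?thesis by (rule power2_le_imp_le) simp
  qed
  then have "bounded U" unfolding bounded_def by (metis dist_commute)
  then have comp: "compact (closure U)" by simp
  have "smap i ` closure U = closure (smap i ` U)" for i
  proof (rule antisym)
    have "continuous_on (closure U) (smap i)" using continuous_on_smap[OF continuous_on_id] by simp
    then show "smap i ` closure U \<subseteq> closure (smap i ` U)"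
      by (rule image_closure_subset) (auto simp: closure_subset)
    have "closed (smap i ` closure U)"
      using comp continuous_on_smap[OF continuous_on_id]
      by (intro compact_imp_closed compact_continuous_image) simp
    then show "closure (smap i ` U) \<subseteq> smap i ` closure U"
      by (intro closure_minimal image_mono closure_subset)
  qed
  then have "gasket_step (closure U) = closure (gasket_step U)"
    unfolding gasket_step_def by (simp add: closure_Un)
  then have "gasket_step (closure U) = closure U" using U by simp
  moreover have "corner 0 \<in> closure U"
  proof -
    have "corner 0 \<in> A 0" unfolding A_def by simp
    then have "corner 0 \<in> U" unfolding U_def by blast
    then show ?thesis using closure_subset[of U] by blast
  qed
  ultimately show ?thesis using comp by blast
qed

lemma gasket_unique:
  assumes "S \<noteq> {}" "compact S" "S = gasket_step S"
    and "S' \<noteq> {}" "compact S'" "S' = gasket_step S'"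
  shows "S = S'"
  using assms invariant_subset[of S S'] invariant_subset[of S' S]
  by (metis compact_imp_bounded order_refl subset_antisym)

lemma gasket_props: "gasket \<noteq> {} \<and> compact gasket \<and> gasket = gasket_step gasket"
  unfolding gasket_def using gasket_exists
  by (rule ex1E[OF ex_ex1I]) (use gasket_unique in blast, rule theI2, blast+)

lemma compact_gasket [simp]: "compact gasket" and gasket_nonempty [simp]: "gasket \<noteq> {}"
  and gasket_step_gasket: "gasket_step gasket = gasket"
  using gasket_props by auto

lemma gasket_eqI:
  assumes "S \<noteq> {}" "compact S" "S = gasket_step S"
  shows "S = gasket"
  using gasket_unique[OF assms] gasket_props by blast

lemma gasket_words: "gasket = (\<Union>w\<in>words k. smap_word w ` gasket)"
  using invariant_words[OF gasket_step_gasket[symmetric]] .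

lemma smap_word_in_gasket: "w \<in> words k \<Longrightarrow> x \<in> gasket \<Longrightarrow> smap_word w x \<in> gasket"
  using gasket_words[of k] by blast

lemma gasket_wordE:
  assumes "x \<in> gasket"
  obtains w y where "w \<in> words k" "y \<in> gasket" "x = smap_word w y"
  using assms gasket_words[of k] by blast

lemma corner_in_gasket [simp]:
  assumes "i \<in> alphabet"
  shows "corner i \<in> gasket"
proof -
  have "{corner i} \<subseteq> gasket_step {corner i}"
    using assms corner_fixed[of i] by (simp add: UN_gasket_step) metis
  then have "{corner i} \<subseteq> gasket"
    using gasket_step_gasket by (intro invariant_subset[of "{corner i}" gasket]) simp_all
  then show ?thesis by simp
qed

text \<open>Extremum principle: a point where the coordinate is maximal is some
  \<open>smap i y'\<close>, so twice the maximum is at most the maximum plus 1. The minimum is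
  treated likewise.\<close>

lemma bary_gasket:
  assumes "x \<in> gasket" "a \<in> alphabet"
  shows "0 \<le> bary a x" "bary a x \<le> 1"
proof -
  have cont: "continuous_on gasket (bary a)"
    using continuous_on_bary[OF continuous_on_id] .
  from continuous_attains_sup[OF _ _ cont] obtain y where
    y: "y \<in> gasket" "\<And>x. x \<in> gasket \<Longrightarrow> bary a x \<le> bary a y" by auto
  from continuous_attains_inf[OF _ _ cont] obtain z where
    z: "z \<in> gasket" "\<And>x. x \<in> gasket \<Longrightarrow> bary a z \<le> bary a x" by auto
  obtain i y' where "i \<in> alphabet" "y' \<in> gasket" "y = smap i y'"
    using y(1) gasket_step_gasket unfolding UN_gasket_step by blast
  then have "bary a y \<le> 1" using y(2)[of y'] assms(2) by (auto simp: bary_smap of_bool_def split: if_splits)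
  then show "bary a x \<le> 1" using y(2)[OF assms(1)] by simp
  obtain j z' where "j \<in> alphabet" "z' \<in> gasket" "z = smap j z'"
    using z(1) gasket_step_gasket unfolding UN_gasket_step by blast
  then have "0 \<le> bary a z" using z(2)[of z'] assms(2) by (auto simp: bary_smap of_bool_def split: if_splits)
  then show "0 \<le> bary a x" using z(2)[OF assms(1)] by simp
qed

lemma dist_gasket_le_1:
  assumes "x \<in> gasket" "y \<in> gasket"
  shows "dist x y \<le> 1"
proof -
  \<comment> \<open>To be applied to the coordinate differences. For \<open>p\<close>,
    \<open>q\<close> of equal sign the sum is \<open>2 * r\<^sup>2 - 2 * (p * q)\<close>; for
    opposite signs it is twice \<open>p\<^sup>2 + q\<^sup>2 + p * q\<close>, where the product
    absorbs the smaller square.\<close>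
  have *: "p\<^sup>2 + q\<^sup>2 + r\<^sup>2 \<le> 2" if "p + q + r = 0" "\<bar>p\<bar> \<le> 1" "\<bar>q\<bar> \<le> 1" "\<bar>r\<bar> \<le> 1" for p q r :: real
  proof -
    have r: "r = - p - q" using that by simp
    show ?thesis
    proof (cases "p * q \<ge> 0")
      case True
      have "p\<^sup>2 + q\<^sup>2 + r\<^sup>2 = 2 * r\<^sup>2 - 2 * (p * q)"
        unfolding r by (simp add: power2_eq_square algebra_simps)
      moreover have "r\<^sup>2 \<le> 1" using that by (simp add: abs_square_le_1)
      ultimately show ?thesis using True by linarith
    next
      case False
      have "p\<^sup>2 + q\<^sup>2 + r\<^sup>2 = 2 * p\<^sup>2 + 2 * q\<^sup>2 + 2 * (p * q)"
        unfolding r by (simp add: power2_eq_square algebra_simps)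
      moreover have "p\<^sup>2 + q\<^sup>2 + p * q \<le> 1"
      proof (cases "\<bar>p\<bar> \<ge> \<bar>q\<bar>")
        case True
        have "q\<^sup>2 = \<bar>q\<bar> * \<bar>q\<bar>" by (simp add: power2_eq_square)
        also have "\<dots> \<le> \<bar>p\<bar> * \<bar>q\<bar>" using True by (intro mult_right_mono) auto
        also have "\<dots> = - (p * q)" using False by (simp add: abs_mult[symmetric])
        finally show ?thesis using that abs_square_le_1[of p] by linarith
      next
        case F: False
        have "p\<^sup>2 = \<bar>p\<bar> * \<bar>p\<bar>" by (simp add: power2_eq_square)
        also have "\<dots> \<le> \<bar>p\<bar> * \<bar>q\<bar>" using F by (intro mult_left_mono) auto
        also have "\<dots> = - (p * q)" using False by (simp add: abs_mult[symmetric])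
        finally show ?thesis using that abs_square_le_1[of q] by linarith
      qed
      ultimately show ?thesis by linarith
    qed
  qed
  have d: "\<bar>bary a x - bary a y\<bar> \<le> 1" if "a \<in> alphabet" for a
    using bary_gasket[OF assms(1) that] bary_gasket[OF assms(2) that] by linarith
  have "(dist x y)\<^sup>2 \<le> 1"
    unfolding dist_bary sum_alphabet
    using *[of "bary 0 x - bary 0 y" "bary 1 x - bary 1 y" "bary 2 x - bary 2 y"]
      sum_bary[of x] sum_bary[of y] d[of 0] d[of 1] d[of 2]
    by (simp add: sum_alphabet)
  then show ?thesis by (simp add: abs_square_le_1)
qed

lemma dist_cell_le:
  assumes "x \<in> gasket" "y \<in> gasket" "w \<in> words k"
  shows "dist (smap_word w x) (smap_word w y) \<le> 1 / 2 ^ k"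
  using dist_gasket_le_1[OF assms(1,2)] assms(3)
  by (simp add: dist_smap_word length_words divide_right_mono)

section \<open>Addresses of cells\<close>

text \<open>\<open>addr 0 w\<close>, \<open>addr 1 w\<close>, \<open>addr 2 w\<close> are the barycentric coordinates of the cell \<open>w\<close> on the lattice of its
  level; they sum to \<open>2 ^ length w - 1\<close>.\<close>

definition addr :: "nat \<Rightarrow> nat list \<Rightarrow> int" where
  "addr a w = foldl (\<lambda>s i. 2 * s + of_bool (i = a)) 0 w"

lemma addr_Nil [simp]: "addr a [] = 0"
  by (simp add: addr_def)

lemma addr_snoc [simp]: "addr a (w @ [i]) = 2 * addr a w + of_bool (i = a)"
  by (simp add: addr_def)

text \<open>The induction removes the last letter, which is the innermost map and the lowest binary
  digit of the address.\<close>

lemma bary_smap_word: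
  assumes "w \<in> words k" "a \<in> alphabet"
  shows "bary a (smap_word w z) = (bary a z + of_int (addr a w)) / 2 ^ k"
  using assms(1)
proof (induction k arbitrary: w z)
  case (Suc k)
  then obtain u i where w: "w = u @ [i]" "u \<in> words k" "i \<in> alphabet"
    unfolding words_snoc by auto
  have "bary a (smap_word w z) = bary a (smap_word u (smap i z))"
    by (simp add: w smap_word_append)
  also have "\<dots> = (bary a (smap i z) + of_int (addr a u)) / 2 ^ k"
    using Suc.IH w by blast
  also have "\<dots> = (bary a z + of_int (addr a w)) / 2 ^ Suc k"
    using w assms(2) by (simp add: bary_smap field_simps)
  finally show ?case .
qed simp

text \<open>Modulo 2 the addresses reveal the last letter; cancelling it leaves twice the addresses
  of the shorter words.\<close>

lemma addr_inj:
  assumes "v \<in> words k" "w \<in> words k" "\<And>a. a \<in> alphabet \<Longrightarrow> addr a v = addr a w"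
  shows "v = w"
  using assms
proof (induction k arbitrary: v w)
  case (Suc k)
  then obtain v' m w' l where vw: "v = v' @ [m]" "v' \<in> words k" "m \<in> alphabet"
    "w = w' @ [l]" "w' \<in> words k" "l \<in> alphabet"
    unfolding words_snoc by auto
  have eq: "2 * addr a v' + of_bool (m = a) = 2 * addr a w' + of_bool (l = a)" if "a \<in> alphabet" for a
    using Suc.prems(3)[OF that] vw by simp
  have "m = l"
    using eq[OF vw(3)] by (cases "m = l") (simp_all, presburger)
  moreover have "v' = w'"
    using Suc.IH[OF vw(2,5)] eq \<open>m = l\<close> by simp
  ultimately show ?case using vw by simp
qed simp

lemma sum_addr:
  assumes "w \<in> words k"
  shows "addr 0 w + addr 1 w + addr 2 w = 2 ^ k - 1"
  using assms
proof (induction k arbitrary: w)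
  case (Suc k)
  then obtain u i where w: "w = u @ [i]" "u \<in> words k" "i \<in> alphabet"
    unfolding words_snoc by auto
  then show ?case using Suc.IH[OF w(2)] by (auto simp: alphabet_def)
qed simp

text \<open>For \<open>p \<noteq> q\<close>, the cell \<open>v\<close> touches corner \<open>p\<close> of the cell \<open>w\<close> with its own corner \<open>q\<close>.\<close>

definition offset :: "nat \<Rightarrow> nat \<Rightarrow> nat list \<Rightarrow> nat list \<Rightarrow> bool" where
  "offset p q v w \<longleftrightarrow>
     (\<forall>a\<in>alphabet. addr a v - addr a w = of_bool (a = p) - of_bool (a = q))"

text \<open>Modulo 2 only the last letters contribute to the addresses.\<close>

lemma offset_snoc:
  assumes "v \<in> words k" "w \<in> words k" "m \<in> alphabet" "l \<in> alphabet" "p \<in> alphabet" "q \<in> alphabet"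
    and "p \<noteq> q" "offset p q (v @ [m]) (w @ [l])"
  shows "l = p \<and> m = q \<and> offset p q v w \<or> l = q"
proof -
  have eq: "2 * (addr a v - addr a w) =
      of_bool (l = a) - of_bool (m = a) + of_bool (a = p) - of_bool (a = q)" if "a \<in> alphabet" for a
    using assms(8) that unfolding offset_def by fastforce
  have "even (of_bool (l = a) - of_bool (m = a) + of_bool (a = p) - of_bool (a = q) :: int)"
    if "a \<in> alphabet" for a
    using eq[OF that] by (metis dvd_triv_left)
  \<comment> \<open>Evenness at \<open>p\<close> and \<open>q\<close> makes \<open>l\<close> and
    \<open>m\<close> equal to \<open>p\<close> and \<open>q\<close> in some order. If
    \<open>l = p\<close>, the right-hand side of \<open>eq\<close> is twice the offset, which thus
    passes to \<open>v\<close>, \<open>w\<close>; if \<open>l = q\<close>, it vanishes and the cells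
    are siblings.\<close>
  from this[of p] this[of q] this[of l] assms
  have *: "l = p \<and> m = q \<or> l = q \<and> m = p"
    by (auto split: if_splits simp: of_bool_def)
  show ?thesis
  proof (cases "l = q")
    case False
    then have "offset p q v w"
      using eq * assms(7) unfolding offset_def by fastforce
    then show ?thesis using * False by simp
  qed simp
qed

text \<open>By \<open>offset_snoc\<close>, a last letter of \<open>w\<close> other than
  \<open>p\<close> would equal both \<open>q\<close> and \<open>r\<close>. So it is
  \<open>p\<close>, and both offsets pass to the shorter words, down to empty words, where they are
  impossible.\<close>

lemma offset_exclusive:
  assumes "w \<in> words k" "v \<in> words k" "v' \<in> words k" "p \<in> alphabet" "q \<in> alphabet" "r \<in> alphabet"
    "p \<noteq> q" "p \<noteq> r" "q \<noteq> r" "offset p q v w" "offset p r v' w"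
  shows False
  using assms
proof (induction k arbitrary: w v v')
  case 0
  then show ?case by (auto simp: offset_def)
next
  case (Suc k)
  then obtain u l where w: "w = u @ [l]" "u \<in> words k" "l \<in> alphabet"
    unfolding words_snoc by auto
  from Suc obtain v1 m where v: "v = v1 @ [m]" "v1 \<in> words k" "m \<in> alphabet"
    unfolding words_snoc by auto
  from Suc obtain v2 m' where v': "v' = v2 @ [m']" "v2 \<in> words k" "m' \<in> alphabet"
    unfolding words_snoc by auto
  show ?case
    using offset_snoc[OF v(2) w(2) v(3) w(3) Suc.prems(4,5,7)] offset_snoc[OF v'(2) w(2) v'(3) w(3) Suc.prems(4,6,8)]
      Suc.prems Suc.IH[OF w(2) v(2) v'(2)] w(1) v(1) v'(1) by metis
qed

text \<open>Here \<open>i\<close> is the last letter of \<open>w\<close>.  Two of the neighbours are the siblings of \<open>w\<close>; the only other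
  one is at corner \<open>i\<close>, and \<open>j\<close> is the corner with which it touches.\<close>

lemma close_cells:
  assumes w: "w \<in> words (Suc k)"
  obtains i j l where "alphabet = {i, j, l}" "i \<noteq> j" "i \<noteq> l" "j \<noteq> l"
    "\<And>v. v \<in> words (Suc k) \<Longrightarrow> (\<And>a. a \<in> alphabet \<Longrightarrow> \<bar>addr a v - addr a w\<bar> \<le> 1) \<Longrightarrow>
       \<exists>(p, q)\<in>{(i, i), (j, i), (l, i), (i, j)}. offset p q v w"
proof -
  obtain u i where u: "w = u @ [i]" "u \<in> words k" "i \<in> alphabet"
    using w unfolding words_snoc by auto
  have "\<exists>j l. alphabet = {i, j, l} \<and> i \<noteq> j \<and> i \<noteq> l \<and> j \<noteq> l"
  proof -
    have "i = 0 \<or> i = 1 \<or> i = 2" using u(3) by (auto simp: alphabet_def)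
    then show ?thesis
    proof (elim disjE)
      assume "i = 0"
      then show ?thesis by (intro exI[of _ 1] exI[of _ 2]) (auto simp: alphabet_def)
    next
      assume "i = 1"
      then show ?thesis by (intro exI[of _ 0] exI[of _ 2]) (auto simp: alphabet_def)
    next
      assume "i = 2"
      then show ?thesis by (intro exI[of _ 0] exI[of _ 1]) (auto simp: alphabet_def)
    qed
  qed
  then obtain j0 l0 where jl0: "alphabet = {i, j0, l0}" "i \<noteq> j0" "i \<noteq> l0" "j0 \<noteq> l0"
    by blast
  \<comment> \<open>By \<open>offset_exclusive\<close>, corner \<open>i\<close> of \<open>w\<close>
    is not touched both by a corner \<open>j0\<close> and by a corner \<open>l0\<close>. The names
    are swapped if necessary, so that \<open>l\<close> is never the touching one.\<close>
  obtain j l where jl: "alphabet = {i, j, l}" "i \<noteq> j" "i \<noteq> l" "j \<noteq> l"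
    and only: "\<And>v. v \<in> words (Suc k) \<Longrightarrow> \<not> offset i l v w"
  proof (cases "\<exists>v\<in>words (Suc k). offset i l0 v w")
    case True
    then obtain v' where v': "v' \<in> words (Suc k)" "offset i l0 v' w" by blast
    have "\<not> offset i j0 v w" if "v \<in> words (Suc k)" for v
      using offset_exclusive[OF w v'(1) that _ _ _ jl0(3,2) _ v'(2)] jl0 by auto
    show ?thesis by (rule that[of l0 j0]) (use jl0 \<open>\<And>v. v \<in> words (Suc k) \<Longrightarrow> \<not> offset i j0 v w\<close> in auto)
  next
    case False
    show ?thesis by (rule that[of j0 l0]) (use False jl0 in auto)
  qed
  show ?thesis
  proof (rule that[OF jl])
    fix v assume v: "v \<in> words (Suc k)" "\<And>a. a \<in> alphabet \<Longrightarrow> \<bar>addr a v - addr a w\<bar> \<le> 1"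
    \<comment> \<open>An integer vector with entries -1, 0, 1 and sum 0 is zero or a difference of
      two unit vectors; \<open>p = q\<close> encodes zero.\<close>
    have "\<exists>p\<in>alphabet. \<exists>q\<in>alphabet. offset p q v w"
    proof -
      define D where "D a = addr a v - addr a w" for a
      have D: "D 0 + D 1 + D 2 = 0"
        using sum_addr[OF w] sum_addr[OF v(1)] by (simp add: D_def)
      have "\<bar>D 0\<bar> \<le> 1" "\<bar>D 1\<bar> \<le> 1" "\<bar>D 2\<bar> \<le> 1"
        using v(2) by (simp_all add: D_def)
      then have c: "D 0 = -1 \<or> D 0 = 0 \<or> D 0 = 1" "D 1 = -1 \<or> D 1 = 0 \<or> D 1 = 1"
        "D 2 \<le> 1" "- 1 \<le> D 2"
        by presburger+
      have D2: "D 2 = - D 0 - D 1" using D by simp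
      consider "D 0 = 0" "D 1 = 0" "D 2 = 0"
        | "D 0 = 1" "D 1 = -1" "D 2 = 0"
        | "D 0 = 1" "D 1 = 0" "D 2 = -1"
        | "D 0 = -1" "D 1 = 1" "D 2 = 0"
        | "D 0 = 0" "D 1 = 1" "D 2 = -1"
        | "D 0 = -1" "D 1 = 0" "D 2 = 1"
        | "D 0 = 0" "D 1 = -1" "D 2 = 1"
        using c unfolding D2 by (elim disjE) simp_all
      then have "\<exists>(p, q)\<in>alphabet \<times> alphabet. offset p q v w"
      proof cases
        case 1
        then show ?thesis unfolding D_def by (intro bexI[of _ "(0, 0)"]) (simp_all add: offset_def ball_alphabet)
      next
        case 2
        then show ?thesis unfolding D_def by (intro bexI[of _ "(0, 1)"]) (simp_all add: offset_def ball_alphabet)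
      next
        case 3
        then show ?thesis unfolding D_def by (intro bexI[of _ "(0, 2)"]) (simp_all add: offset_def ball_alphabet)
      next
        case 4
        then show ?thesis unfolding D_def by (intro bexI[of _ "(1, 0)"]) (simp_all add: offset_def ball_alphabet)
      next
        case 5
        then show ?thesis unfolding D_def by (intro bexI[of _ "(1, 2)"]) (simp_all add: offset_def ball_alphabet)
      next
        case 6
        then show ?thesis unfolding D_def by (intro bexI[of _ "(2, 0)"]) (simp_all add: offset_def ball_alphabet)
      next
        case 7
        then show ?thesis unfolding D_def by (intro bexI[of _ "(2, 1)"]) (simp_all add: offset_def ball_alphabet)
      qed
      then show ?thesis by blast
    qed
    then obtain p q where pq: "p \<in> alphabet" "q \<in> alphabet" "offset p q v w" by blast
    show "\<exists>(p, q)\<in>{(i, i), (j, i), (l, i), (i, j)}. offset p q v w"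
    proof (cases "p = q")
      case True
      then have "offset i i v w" using pq by (simp add: offset_def)
      then show ?thesis by simp
    next
      case False
      obtain v1 m where v1: "v = v1 @ [m]" "v1 \<in> words k" "m \<in> alphabet"
        using v unfolding words_snoc by auto
      have "i = p \<or> i = q"
        using offset_snoc[OF v1(2) u(2) v1(3) u(3) pq(1,2) False] pq(3) v1(1) u(1) by auto
      then show ?thesis
        using pq False jl only[OF v(1)] by auto
    qed
  qed
qed

section \<open>The self-similar measure\<close>

text \<open>A predicate, not a constant: images under symmetries satisfy it again, and any two such
  measures agree on balls. Symmetry of the measure is obtained in this way.\<close>

definition self_similar :: "(real^2) measure \<Rightarrow> bool" where
  "self_similar M \<longleftrightarrow> prob_space M \<and> sets M = sets borel \<and> measure M gasket = 1 \<and>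
     (\<forall>B\<in>sets borel. measure M B = (\<Sum>i\<in>alphabet. measure M (smap i -` B)) / 3)"

definition letter_measure :: "nat measure" where
  "letter_measure = measure_pmf (pmf_of_set alphabet)"

text \<open>The point with infinite coding \<open>\<omega>\<close>: expanding
  \<open>smap (\<omega> 0) (smap (\<omega> 1) ...)\<close> leaves this series of
  translations.\<close>

definition point_of :: "(nat \<Rightarrow> nat) \<Rightarrow> real^2" where
  "point_of \<omega> = (\<Sum>n. (1/2) ^ n *\<^sub>R shift (\<omega> n))"

definition shift_bound :: real where
  "shift_bound = norm (shift 0) + norm (shift 1) + norm (shift 2)"

lemma norm_shift_le: "norm (shift i) \<le> shift_bound"
proof -
  have "shift i \<in> {shift 0, shift 1, shift 2}" by (auto simp: shift_def)
  then show ?thesis by (auto simp: shift_bound_def)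
qed

lemma summable_point_of: "summable (\<lambda>n. (1/2) ^ n *\<^sub>R shift (\<omega> n))"
proof (rule summable_comparison_test')
  show "norm ((1/2) ^ n *\<^sub>R shift (\<omega> n)) \<le> (1/2) ^ n * shift_bound" for n
    using norm_shift_le by simp
  show "summable (\<lambda>n. (1/2) ^ n * shift_bound)" by (intro summable_mult2 summable_geometric) simp
qed

lemma point_of_case_nat: "point_of (case_nat i \<omega>) = smap i (point_of \<omega>)"
proof -
  have "point_of (case_nat i \<omega>) = (\<Sum>n. (1/2) ^ Suc n *\<^sub>R shift (\<omega> n)) + shift i"
    unfolding point_of_def using suminf_split_head[OF summable_point_of[of "case_nat i \<omega>"]] by simp
  also have "(\<Sum>n. (1/2) ^ Suc n *\<^sub>R shift (\<omega> n)) = (\<Sum>n. (1/2) *\<^sub>R ((1/2) ^ n *\<^sub>R shift (\<omega> n)))"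
    by simp
  also have "\<dots> = (1/2) *\<^sub>R point_of \<omega>"
    unfolding point_of_def by (rule suminf_scaleR_right[OF summable_point_of, symmetric])
  finally show ?thesis by (simp add: smap_def)
qed

text \<open>Splitting off the first letter shows that the bounded set of all coded points lies in
  its own image under \<open>gasket_step\<close>, so \<open>invariant_subset\<close>
  applies.\<close>

lemma point_of_in_gasket:
  assumes "\<And>n. \<omega> n \<in> alphabet"
  shows "point_of \<omega> \<in> gasket"
proof -
  let ?A = "point_of ` {\<omega>. \<forall>n. \<omega> n \<in> alphabet}"
  have "?A \<subseteq> gasket"
  proof (rule invariant_subset)
    have "norm (point_of \<omega>) \<le> (\<Sum>n. (1/2) ^ n * shift_bound)" for \<omega>
      unfolding point_of_def
    proof (rule norm_suminf_le)
      show "norm ((1/2) ^ n *\<^sub>R shift (\<omega> n)) \<le> (1/2) ^ n * shift_bound" for n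
        using norm_shift_le by simp
      show "summable (\<lambda>n. (1/2) ^ n * shift_bound)" by (intro summable_mult2 summable_geometric) simp
    qed
    then show "bounded ?A" unfolding bounded_iff by blast
    show "?A \<subseteq> gasket_step ?A"
    proof (clarify)
      fix \<omega> :: "nat \<Rightarrow> nat" assume *: "\<forall>n. \<omega> n \<in> alphabet"
      have "\<omega> = case_nat (\<omega> 0) (\<lambda>n. \<omega> (Suc n))" by (auto split: nat.split)
      then have "point_of \<omega> = smap (\<omega> 0) (point_of (\<lambda>n. \<omega> (Suc n)))"
        using point_of_case_nat by metis
      then show "point_of \<omega> \<in> gasket_step ?A"
        using * unfolding UN_gasket_step by blast
    qed
  qed (use gasket_step_gasket in auto)
  then show ?thesis using assms by blast
qed

lemma closed_gasket [simp]: "closed gasket"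
  by (simp add: compact_imp_closed)

lemma smap_measurable [measurable]: "smap i \<in> borel_measurable borel"
  using continuous_on_smap[OF continuous_on_id] by (intro borel_measurable_continuous_onI) simp

lemma smap_word_measurable [measurable]: "smap_word w \<in> borel_measurable borel"
  using continuous_on_smap_word[OF continuous_on_id] by (intro borel_measurable_continuous_onI) simp

lemma smap_vimage_borel: "B \<in> sets borel \<Longrightarrow> smap i -` B \<in> sets borel"
  using measurable_sets[OF smap_measurable] by simp

lemma smap_word_vimage_borel: "B \<in> sets borel \<Longrightarrow> smap_word w -` B \<in> sets borel"
  using measurable_sets[OF smap_word_measurable] by simp

text \<open>The measure is the law of \<open>point_of \<omega>\<close> for independent uniform
  letters; splitting off the first letter of the product measure yields the invariance
  equation.\<close>

lemma self_similar_exists: "\<exists>M. self_similar M"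
proof -
  interpret L: prob_space letter_measure
    unfolding letter_measure_def by (rule measure_pmf.prob_space_axioms)
  have [measurable_cong]: "sets letter_measure = sets (count_space UNIV)"
    by (simp add: letter_measure_def)
  interpret sequence_space letter_measure
    by unfold_locales
  have [measurable]: "point_of \<in> borel_measurable S"
    unfolding point_of_def
  proof (rule borel_measurable_suminf)
    fix n
    have "shift \<in> measurable (count_space UNIV) borel" by simp
    moreover have "(\<lambda>\<omega>. \<omega> n) \<in> measurable S (count_space UNIV)" by measurable
    ultimately have "(\<lambda>\<omega>. shift (\<omega> n)) \<in> borel_measurable S" by (rule measurable_compose[rotated])
    then show "(\<lambda>\<omega>. (1/2) ^ n *\<^sub>R shift (\<omega> n)) \<in> borel_measurable S" by measurable
  qed
  define M where "M = distr S borel point_of"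
  interpret M: prob_space M unfolding M_def by (rule P.prob_space_distr) measurable
  have em: "emeasure M B = (\<Sum>i\<in>alphabet. emeasure M (smap i -` B)) / 3" if B[measurable]: "B \<in> sets borel" for B
  proof -
    have "emeasure M B = emeasure S (point_of -` B \<inter> space S)"
      unfolding M_def by (rule emeasure_distr) measurable
    also have "\<dots> = emeasure (letter_measure \<Otimes>\<^sub>M S)
        ((\<lambda>(s, \<omega>). case_nat s \<omega>) -` (point_of -` B \<inter> space S) \<inter> space (letter_measure \<Otimes>\<^sub>M S))"
      by (subst PiM_iter[symmetric], rule emeasure_distr) measurable
    also have "\<dots> = (\<integral>\<^sup>+ i. emeasure S (point_of -` (smap i -` B) \<inter> space S) \<partial>letter_measure)"
    proof (subst P.emeasure_pair_measure_alt)
      show "(\<lambda>(s, \<omega>). case_nat s \<omega>) -` (point_of -` B \<inter> space S) \<inter> space (letter_measure \<Otimes>\<^sub>M S)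
        \<in> sets (letter_measure \<Otimes>\<^sub>M S)"
        by measurable
      show "(\<integral>\<^sup>+ x. emeasure S (Pair x -` ((\<lambda>(s, \<omega>). case_nat s \<omega>) -` (point_of -` B \<inter> space S) \<inter>
          space (letter_measure \<Otimes>\<^sub>M S))) \<partial>letter_measure) =
        (\<integral>\<^sup>+ i. emeasure S (point_of -` (smap i -` B) \<inter> space S) \<partial>letter_measure)"
        by (intro nn_integral_cong arg_cong[where f = "emeasure S"])
          (auto simp: space_pair_measure point_of_case_nat space_PiM letter_measure_def)
    qed
    also have "\<dots> = (\<integral>\<^sup>+ i. emeasure M (smap i -` B) \<partial>letter_measure)"
      unfolding M_def by (intro nn_integral_cong, subst emeasure_distr) (auto intro: smap_vimage_borel)
    also have "\<dots> = (\<Sum>i\<in>alphabet. emeasure M (smap i -` B)) / of_nat (card alphabet)"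
      unfolding letter_measure_def by (rule nn_integral_pmf_of_set) (auto simp: alphabet_def)
    also have "of_nat (card alphabet) = (3::ennreal)" by (simp add: alphabet_def)
    finally show ?thesis .
  qed
  have "measure M B = (\<Sum>i\<in>alphabet. measure M (smap i -` B)) / 3" if B: "B \<in> sets borel" for B
  proof -
    have "ennreal (measure M B) = ennreal ((\<Sum>i\<in>alphabet. measure M (smap i -` B)) / 3)"
      using em[OF B] by (simp add: M.emeasure_eq_measure sum_ennreal sum_nonneg flip: divide_ennreal)
    then show ?thesis by (simp add: sum_nonneg)
  qed
  moreover have "measure M gasket = 1"
  proof -
    have "AE \<omega> in S. \<forall>n. \<omega> n \<in> alphabet"
    proof (subst AE_all_countable, rule allI)
      fix n
      have "AE i in letter_measure. i \<in> alphabet"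
        unfolding letter_measure_def by (simp add: AE_measure_pmf_iff) (simp add: alphabet_def)
      then show "AE \<omega> in S. \<omega> n \<in> alphabet"
        using AE_PiM_component[of UNIV "\<lambda>_. letter_measure" n] L.prob_space_axioms by simp
    qed
    then have "AE \<omega> in S. point_of \<omega> \<in> gasket"
      by eventually_elim (simp add: point_of_in_gasket)
    then have "AE x in M. x \<in> gasket"
      unfolding M_def by (subst AE_distr_iff) (auto simp: borel_closed)
    then show ?thesis using M.prob_eq_1[of gasket] by (simp add: M_def borel_closed)
  qed
  ultimately have "self_similar M"
    unfolding self_similar_def using M.prob_space_axioms by (simp add: M_def)
  then show ?thesis ..
qed

lemma self_similar_words:
  assumes "self_similar M" "B \<in> sets borel"
  shows "measure M B = (\<Sum>w\<in>words k. measure M (smap_word w -` B)) / 3 ^ k"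
  using assms(2)
proof (induction k arbitrary: B)
  case (Suc k)
  have "measure M B = (\<Sum>i\<in>alphabet. measure M (smap i -` B)) / 3"
    using assms(1) Suc.prems unfolding self_similar_def by blast
  also have "\<dots> = (\<Sum>i\<in>alphabet. (\<Sum>w\<in>words k. measure M (smap_word w -` (smap i -` B))) / 3 ^ k) / 3"
    using Suc.IH[OF smap_vimage_borel[OF Suc.prems]] by simp
  also have "\<dots> = (\<Sum>i\<in>alphabet. \<Sum>w\<in>words k. measure M (smap_word (i # w) -` B)) / 3 ^ Suc k"
    by (simp add: sum_divide_distrib vimage_comp mult.commute)
  finally show ?case by (simp add: sum_words_Suc)
qed simp

lemma self_similar_null:
  assumes M: "self_similar M" and B: "B \<in> sets borel" "B \<inter> gasket = {}"
  shows "measure M B = 0"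
proof -
  interpret prob_space M using M by (simp add: self_similar_def)
  have s: "sets M = sets borel" and g: "measure M gasket = 1"
    using M by (auto simp: self_similar_def)
  have "measure M (B \<union> gasket) = measure M B + measure M gasket"
    using B s by (intro finite_measure_Union) auto
  moreover have "measure M (B \<union> gasket) \<le> 1" by simp
  ultimately show ?thesis using g measure_nonneg[of M B] by linarith
qed

lemma self_similar_full:
  assumes M: "self_similar M" and B: "B \<in> sets borel" "gasket \<subseteq> B"
  shows "measure M B = 1"
proof -
  interpret prob_space M using M by (simp add: self_similar_def)
  have s: "sets M = sets borel" and g: "measure M gasket = 1"
    using M by (auto simp: self_similar_def)
  have "measure M gasket \<le> measure M B"
    using B s by (intro finite_measure_mono) auto
  then show ?thesis using g prob_le_1[of B] by linarith
qed

section \<open>Comparison with the discrete measures\<close>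

lemma measure_mu:
  assumes "B \<in> sets borel"
  shows "measure (mu k) B =
    (\<Sum>w\<in>words (k - 1). \<Sum>i\<in>alphabet. of_bool (smap_word w (corner i) \<in> B)) / 3 ^ k"
proof -
  have "mu_fun k B = ennreal (1 / 3 ^ k) *
      (\<Sum>w\<in>words (k - 1). \<Sum>i\<in>alphabet. ennreal (of_bool (smap_word w (corner i) \<in> B)))"
  proof -
    have "1 / 3 ^ k = ennreal (1 / 3 ^ k)"
      by (simp add: divide_ennreal[symmetric] ennreal_power[symmetric])
    moreover have "indicator B x = ennreal (of_bool (x \<in> B))" for x
      by (simp add: indicator_def)
    ultimately show ?thesis
      using assms unfolding mu_fun_def sum_alphabet by simp
  qed
  also have "\<dots> = ennreal ((\<Sum>w\<in>words (k - 1). \<Sum>i\<in>alphabet. of_bool (smap_word w (corner i) \<in> B)) / 3 ^ k)"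
    by (simp add: sum_ennreal sum_nonneg ennreal_mult[symmetric])
  finally have "emeasure (mu k) B = \<dots>" using assms by (simp add: emeasure_mu)
  then show ?thesis unfolding measure_def by (simp add: sum_nonneg)
qed

text \<open>Indexed as in \<open>measure_mu\<close>, so that level-\<open>k\<close> cells and atoms
  can be compared term by term.\<close>

lemma self_similar_snoc:
  assumes "self_similar M" "B \<in> sets borel" "k \<ge> 1"
  shows "measure M B =
    (\<Sum>w\<in>words (k - 1). \<Sum>i\<in>alphabet. measure M (smap_word (w @ [i]) -` B)) / 3 ^ k"
proof -
  obtain k' where "k = Suc k'" using assms(3) by (cases k) auto
  then show ?thesis using self_similar_words[OF assms(1,2), of k] by (simp add: sum_words_snoc)
qed

lemma words_snoc_in: "w \<in> words (k - 1) \<Longrightarrow> i \<in> alphabet \<Longrightarrow> k \<ge> 1 \<Longrightarrow> w @ [i] \<in> words k"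
  by (auto simp: words_def)

text \<open>As \<open>corner i\<close> is fixed by \<open>smap i\<close>, the atom for
  \<open>w\<close> and \<open>i\<close> lies in the level-\<open>k\<close> cell of
  \<open>w @ [i]\<close>, although \<open>w\<close> has only \<open>k - 1\<close> letters.\<close>

lemma dist_atom_le:
  assumes "w \<in> words (k - 1)" "i \<in> alphabet" "k \<ge> 1" "y \<in> gasket"
  shows "dist (smap_word (w @ [i]) y) (smap_word w (corner i)) \<le> 1 / 2 ^ k"
proof -
  have "smap_word w (corner i) = smap_word (w @ [i]) (corner i)"
    by (simp add: smap_word_append corner_fixed)
  then show ?thesis
    using dist_cell_le[OF assms(4) corner_in_gasket[OF assms(2)] words_snoc_in[OF assms(1-3)]] by simp
qed

text \<open>A cell that misses the ball contributes nothing to the left; a cell that meets it has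
  its atom in the enlarged ball.\<close>

lemma self_similar_le_mu:
  assumes M: "self_similar M" and k: "k \<ge> 1"
  shows "measure M (cball x d) \<le> measure (mu k) (cball x (d + 1 / 2 ^ k))"
proof -
  have "measure M (smap_word (w @ [i]) -` cball x d)
      \<le> of_bool (smap_word w (corner i) \<in> cball x (d + 1 / 2 ^ k))"
    if wi: "w \<in> words (k - 1)" "i \<in> alphabet" for w i
  proof (cases "(smap_word (w @ [i]) -` cball x d) \<inter> gasket = {}")
    case True
    then show ?thesis
      by (subst self_similar_null[OF M smap_word_vimage_borel]) auto
  next
    case False
    then obtain y where y: "y \<in> gasket" "dist x (smap_word (w @ [i]) y) \<le> d" by auto
    have "dist (smap_word (w @ [i]) y) (smap_word w (corner i)) \<le> 1 / 2 ^ k"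
      using dist_atom_le[OF wi k y(1)] .
    then have "dist x (smap_word w (corner i)) \<le> d + 1 / 2 ^ k"
      using y(2) dist_triangle[of x "smap_word w (corner i)" "smap_word (w @ [i]) y"] by linarith
    moreover have "measure M A \<le> 1" for A
      using M by (intro prob_space.prob_le_1) (auto simp: self_similar_def)
    ultimately show ?thesis by simp
  qed
  then show ?thesis
    by (subst measure_mu, simp, subst self_similar_snoc[OF M _ k], simp)
      (intro divide_right_mono sum_mono, auto)
qed

text \<open>If an atom lies in the ball, its whole cell lies in the enlarged one and contributes
  fully.\<close>

lemma mu_le_self_similar:
  assumes M: "self_similar M" and k: "k \<ge> 1"
  shows "measure (mu k) (cball x d) \<le> measure M (cball x (d + 1 / 2 ^ k))"
proof -
  have "of_bool (smap_word w (corner i) \<in> cball x d)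
      \<le> measure M (smap_word (w @ [i]) -` cball x (d + 1 / 2 ^ k))"
    if wi: "w \<in> words (k - 1)" "i \<in> alphabet" for w i
  proof (cases "smap_word w (corner i) \<in> cball x d")
    case True
    have "gasket \<subseteq> smap_word (w @ [i]) -` cball x (d + 1 / 2 ^ k)"
    proof
      fix y assume y: "y \<in> gasket"
      have "dist (smap_word w (corner i)) (smap_word (w @ [i]) y) \<le> 1 / 2 ^ k"
        using dist_atom_le[OF wi k y] by (simp add: dist_commute)
      then have "dist x (smap_word (w @ [i]) y) \<le> d + 1 / 2 ^ k"
        using True dist_triangle[of x "smap_word (w @ [i]) y" "smap_word w (corner i)"]
        unfolding mem_cball by linarith
      then show "y \<in> smap_word (w @ [i]) -` cball x (d + 1 / 2 ^ k)" by simp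
    qed
    then show ?thesis
      by (subst self_similar_full[OF M smap_word_vimage_borel]) auto
  qed simp
  then show ?thesis
    by (subst measure_mu, simp, subst self_similar_snoc[OF M _ k], simp)
      (intro divide_right_mono sum_mono, auto)
qed

text \<open>Passing through the same \<open>mu k\<close> costs \<open>2 / 2 ^ k\<close> in the
  radius, which continuity of \<open>M'\<close> from above removes. Exchanging the measures gives
  equality on balls.\<close>

lemma self_similar_cball_le:
  assumes M: "self_similar M" and M': "self_similar M'"
  shows "measure M (cball x d) \<le> measure M' (cball x d)"
proof -
  interpret M': prob_space M' using M' by (simp add: self_similar_def)
  have s: "sets M' = sets borel" using M' by (simp add: self_similar_def)
  define A where "A n = cball x (d + 2 / 2 ^ Suc n)" for n :: nat
  have lim: "(\<lambda>n. d + 2 / 2 ^ Suc n) \<longlonglongrightarrow> d + 0"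
    by (intro tendsto_add tendsto_const LIMSEQ_Suc LIMSEQ_divide_realpow_zero) simp
  have "(\<lambda>n. measure M' (A n)) \<longlonglongrightarrow> measure M' (\<Inter>n. A n)"
  proof (rule M'.finite_Lim_measure_decseq)
    show "range A \<subseteq> sets M'" by (auto simp: A_def s)
    show "decseq A" unfolding A_def decseq_def
    proof (intro allI impI subset_cball)
      fix m n :: nat assume "m \<le> n"
      then show "d + 2 / 2 ^ Suc n \<le> d + 2 / 2 ^ Suc m"
        by (intro add_left_mono divide_left_mono power_increasing) auto
    qed
  qed
  also have "(\<Inter>n. A n) = cball x d"
  proof (rule antisym)
    show "(\<Inter>n. A n) \<subseteq> cball x d"
    proof
      fix y assume "y \<in> (\<Inter>n. A n)"
      then have "dist x y \<le> d + 2 / 2 ^ Suc n" for n by (auto simp: A_def)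
      then have "dist x y \<le> d + 0" by (intro LIMSEQ_le_const[OF lim]) auto
      then show "y \<in> cball x d" by simp
    qed
  next
    show "cball x d \<subseteq> (\<Inter>n. A n)"
    proof
      fix y assume "y \<in> cball x d"
      moreover have "0 \<le> 2 / (2::real) ^ Suc n" for n by simp
      ultimately have "dist x y \<le> d + 2 / 2 ^ Suc n" for n
        unfolding mem_cball by (meson add_increasing2)
      then show "y \<in> (\<Inter>n. A n)" by (simp add: A_def)
    qed
  qed
  finally have "(\<lambda>n. measure M' (A n)) \<longlonglongrightarrow> measure M' (cball x d)" .
  moreover have "measure M (cball x d) \<le> measure M' (A n)" for n
  proof -
    have "measure M (cball x d) \<le> measure (mu (Suc n)) (cball x (d + 1 / 2 ^ Suc n))"
      by (rule self_similar_le_mu[OF M]) simp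
    also have "\<dots> \<le> measure M' (cball x (d + 1 / 2 ^ Suc n + 1 / 2 ^ Suc n))"
      by (rule mu_le_self_similar[OF M']) simp
    finally show ?thesis by (simp add: A_def add_divide_distrib[symmetric] add.assoc)
  qed
  ultimately show ?thesis by (intro LIMSEQ_le_const) auto
qed

section \<open>Symmetries of the gasket and reduction of small balls\<close>

definition perm_map :: "(nat \<Rightarrow> nat) \<Rightarrow> real^2 \<Rightarrow> real^2" where
  "perm_map \<tau> x = (\<Sum>a\<in>alphabet. bary a x *\<^sub>R corner (\<tau> a))"

lemma bary_combination:
  assumes "(\<Sum>a\<in>alphabet. g a) = 1" "b \<in> alphabet"
  shows "bary b (\<Sum>a\<in>alphabet. g a *\<^sub>R c a) = (\<Sum>a\<in>alphabet. g a * bary b (c a))"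
proof -
  have g: "g 0 = 1 - g 1 - g 2" using assms(1) unfolding sum_alphabet by simp
  have "b = 0 \<or> b = 1 \<or> b = 2" using assms(2) by (auto simp: alphabet_def)
  then show ?thesis
    unfolding sum_alphabet g by (elim disjE) (simp_all add: bary_def add_divide_distrib diff_divide_distrib algebra_simps)
qed

lemma bary_perm_map:
  assumes "bij_betw \<tau> alphabet alphabet" "b \<in> alphabet"
  shows "bary (\<tau> b) (perm_map \<tau> x) = bary b x"
proof -
  have \<tau>: "\<tau> a \<in> alphabet" if "a \<in> alphabet" for a
    using bij_betw_apply[OF assms(1) that] .
  have "bary (\<tau> b) (perm_map \<tau> x) = (\<Sum>a\<in>alphabet. bary a x * bary (\<tau> b) (corner (\<tau> a)))"
    unfolding perm_map_def by (rule bary_combination[OF sum_bary \<tau>[OF assms(2)]])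
  also have "\<dots> = (\<Sum>a\<in>alphabet. if a = b then bary a x else 0)"
  proof (rule sum.cong)
    fix a assume a: "a \<in> alphabet"
    have "\<tau> a = \<tau> b \<longleftrightarrow> a = b"
      using bij_betw_imp_inj_on[OF assms(1)] a assms(2) by (auto simp: inj_on_def)
    then show "bary a x * bary (\<tau> b) (corner (\<tau> a)) = (if a = b then bary a x else 0)"
      using \<tau> a assms(2) by (simp add: bary_corner)
  qed simp
  also have "\<dots> = bary b x" using assms(2) by simp
  finally show ?thesis .
qed

lemma bary_perm_eqI:
  assumes "bij_betw \<tau> alphabet alphabet" "\<And>a. a \<in> alphabet \<Longrightarrow> bary (\<tau> a) x = bary (\<tau> a) y"
  shows "x = y"
proof (rule bary_eqI)
  fix a assume "a \<in> alphabet"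
  then obtain b where "b \<in> alphabet" "a = \<tau> b"
    using assms(1) unfolding bij_betw_def by blast
  then show "bary a x = bary a y" using assms(2) by simp
qed

lemma perm_map_smap:
  assumes "bij_betw \<tau> alphabet alphabet" "i \<in> alphabet"
  shows "perm_map \<tau> (smap i x) = smap (\<tau> i) (perm_map \<tau> x)"
proof (rule bary_perm_eqI[OF assms(1)])
  fix a assume a: "a \<in> alphabet"
  have \<tau>: "\<tau> a \<in> alphabet" if "a \<in> alphabet" for a
    using bij_betw_apply[OF assms(1) that] .
  have "\<tau> i = \<tau> a \<longleftrightarrow> i = a"
    using bij_betw_imp_inj_on[OF assms(1)] a assms(2) by (auto simp: inj_on_def)
  then show "bary (\<tau> a) (perm_map \<tau> (smap i x)) = bary (\<tau> a) (smap (\<tau> i) (perm_map \<tau> x))"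
    using a assms \<tau> by (simp add: bary_perm_map bary_smap)
qed

lemma continuous_on_perm_map: "continuous_on A (perm_map \<tau>)"
  unfolding perm_map_def by (intro continuous_intros)

text \<open>A symmetry only permutes the three pieces, so the image solves the same fixed-set
  equation.\<close>

lemma perm_map_gasket:
  assumes "bij_betw \<tau> alphabet alphabet"
  shows "perm_map \<tau> ` gasket = gasket"
proof (rule gasket_eqI)
  show "compact (perm_map \<tau> ` gasket)"
    by (intro compact_continuous_image continuous_on_perm_map compact_gasket)
  have "perm_map \<tau> ` gasket = perm_map \<tau> ` (\<Union>i\<in>alphabet. smap i ` gasket)"
    using gasket_step_gasket by (simp add: UN_gasket_step)
  also have "\<dots> = (\<Union>i\<in>alphabet. (\<lambda>x. perm_map \<tau> (smap i x)) ` gasket)"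
    by (simp add: image_UN image_image)
  also have "\<dots> = (\<Union>i\<in>alphabet. smap (\<tau> i) ` perm_map \<tau> ` gasket)"
    by (intro SUP_cong refl) (simp add: perm_map_smap[OF assms] image_image)
  also have "\<dots> = (\<Union>i\<in>\<tau> ` alphabet. smap i ` perm_map \<tau> ` gasket)"
    by simp
  also have "\<tau> ` alphabet = alphabet" using assms by (simp add: bij_betw_def)
  finally show "perm_map \<tau> ` gasket = gasket_step (perm_map \<tau> ` gasket)"
    by (simp add: UN_gasket_step)
qed simp

lemma self_similar_perm_map:
  assumes M: "self_similar M" and \<tau>: "bij_betw \<tau> alphabet alphabet"
  shows "self_similar (distr M borel (perm_map \<tau>))"
proof -
  interpret prob_space M using M by (simp add: self_similar_def)
  have s: "sets M = sets borel" using M by (simp add: self_similar_def)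
  have sp: "space M = UNIV" using sets_eq_imp_space_eq[OF s] by simp
  have "perm_map \<tau> \<in> borel_measurable borel"
    using continuous_on_perm_map by (rule borel_measurable_continuous_onI)
  then have meas: "perm_map \<tau> \<in> borel_measurable M"
    using measurable_cong_sets[OF s refl] by blast
  have d: "measure (distr M borel (perm_map \<tau>)) B = measure M (perm_map \<tau> -` B)"
    if "B \<in> sets borel" for B
    using that by (simp add: measure_distr[OF meas] sp)
  have vb: "perm_map \<tau> -` B \<in> sets borel" if "B \<in> sets borel" for B
    using measurable_sets[OF meas that] sp s by simp
  have "measure M (perm_map \<tau> -` B) = (\<Sum>i\<in>alphabet. measure M (perm_map \<tau> -` (smap i -` B))) / 3"
    if B: "B \<in> sets borel" for B
  proof -
    have "measure M (perm_map \<tau> -` B) = (\<Sum>i\<in>alphabet. measure M (smap i -` (perm_map \<tau> -` B))) / 3"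
      using M vb[OF B] by (simp add: self_similar_def)
    also have "(\<Sum>i\<in>alphabet. measure M (smap i -` (perm_map \<tau> -` B)))
        = (\<Sum>i\<in>alphabet. measure M (perm_map \<tau> -` (smap (\<tau> i) -` B)))"
      by (intro sum.cong refl arg_cong[where f = "measure M"]) (auto simp: perm_map_smap[OF \<tau>])
    also have "\<dots> = (\<Sum>i\<in>alphabet. measure M (perm_map \<tau> -` (smap i -` B)))"
      by (rule sum.reindex_bij_betw[OF \<tau>])
    finally show ?thesis .
  qed
  moreover have "measure M (perm_map \<tau> -` gasket) = 1"
    using perm_map_gasket[OF \<tau>] vb[of gasket] by (intro self_similar_full[OF M]) auto
  ultimately show ?thesis
    unfolding self_similar_def using prob_space_distr[OF meas] smap_vimage_borel
    by (simp add: d)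
qed

text \<open>Symmetry of the measure is used on balls only, so preimages of balls under cell maps
  must again be balls.\<close>

lemma smap_word_vimage_cball: "\<exists>c r. smap_word w -` cball z d = cball c r"
proof (induction w arbitrary: z d)
  case Nil
  then show ?case by auto
next
  case (Cons i w)
  have "dist z (smap i y) \<le> d \<longleftrightarrow> dist (2 *\<^sub>R (z - shift i)) y \<le> 2 * d" for y
  proof -
    have "z - smap i y = (1/2) *\<^sub>R (2 *\<^sub>R (z - shift i) - y)"
      by (simp add: smap_def algebra_simps)
    then show ?thesis by (simp add: dist_norm mult.commute)
  qed
  then have "smap i -` cball z d = cball (2 *\<^sub>R (z - shift i)) (2 * d)"
    by (auto simp: set_eq_iff)
  then have "smap_word (i # w) -` cball z d = smap_word w -` cball (2 *\<^sub>R (z - shift i)) (2 * d)"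
    by (simp add: vimage_comp[symmetric])
  then show ?case using Cons.IH by metis
qed

lemma dist_scaled_perm:
  assumes "bij_betw \<tau> alphabet alphabet" "0 \<le> c"
    and "\<And>a. a \<in> alphabet \<Longrightarrow> bary (\<tau> a) u - bary (\<tau> a) v = c * (bary a x - bary a y)"
  shows "dist u v = c * dist x y"
proof -
  have "(dist u v)\<^sup>2 = (\<Sum>a\<in>alphabet. (bary (\<tau> a) u - bary (\<tau> a) v)\<^sup>2) / 2"
    unfolding dist_bary
    by (subst sum.reindex_bij_betw[OF assms(1), of "\<lambda>a. (bary a u - bary a v)\<^sup>2"]) simp
  also have "\<dots> = (\<Sum>a\<in>alphabet. c\<^sup>2 * (bary a x - bary a y)\<^sup>2) / 2"
    using assms(3) by (simp add: power_mult_distrib)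
  also have "\<dots> = (c * dist x y)\<^sup>2"
    by (simp add: power_mult_distrib dist_bary sum_distrib_left[symmetric])
  finally show ?thesis using assms(2) by (simp add: power2_eq_iff_nonneg)
qed

text \<open>The bound on \<open>d\<close> is the height of a cell of level \<open>Suc k\<close>, so
  the ball meets only cells with adjacent addresses. These correspond injectively to level-2 cells
  around \<open>[0, 1]\<close>, with all distances to the centre scaled alike;
  \<open>9 / 3 ^ Suc k\<close> is the ratio of the cell masses.\<close>

lemma ball_reduction:
  assumes M: "self_similar M" and x: "x \<in> gasket" and d: "d < sqrt 3 / 2 / 2 ^ Suc k"
  shows "\<exists>x'\<in>cell [0, 1]. measure M (cball x d) \<le> 9 / 3 ^ Suc k * measure M (cball x' (2 ^ Suc k / 4 * d))"
proof -
  define n where "n = Suc k"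
  obtain w \<xi> where w: "w \<in> words n" "\<xi> \<in> gasket" "x = smap_word w \<xi>"
    using gasket_wordE[OF x] .
  obtain i j l where ijl: "alphabet = {i, j, l}" "i \<noteq> j" "i \<noteq> l" "j \<noteq> l"
    and close: "\<And>v. v \<in> words n \<Longrightarrow> (\<And>a. a \<in> alphabet \<Longrightarrow> \<bar>addr a v - addr a w\<bar> \<le> 1) \<Longrightarrow>
       \<exists>(p, q)\<in>{(i, i), (j, i), (l, i), (i, j)}. offset p q v w"
    using close_cells[of w k] w unfolding n_def by metis
  \<comment> \<open>In the model configuration \<open>[1, 0]\<close> touches corner 1 of
    \<open>[0, 1]\<close> with its own corner 0. Hence \<open>i\<close> goes to 1 and
    \<open>j\<close> to 0.\<close>
  define \<tau> where "\<tau> a = (if a = i then 1 else if a = j then 0 else (2 :: nat))" for a :: nat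
  have \<tau>_vals: "\<tau> i = 1" "\<tau> j = 0" "\<tau> l = 2"
    using ijl(2-4) by (auto simp: \<tau>_def)
  have \<tau>: "bij_betw \<tau> alphabet alphabet"
  proof -
    have "\<tau> ` {i, j, l} = {1, 0, 2}" by (simp add: \<tau>_vals)
    then have "\<tau> ` alphabet = alphabet" unfolding ijl(1)[symmetric] by (auto simp: alphabet_def)
    then show ?thesis by (simp add: bij_betw_def eq_card_imp_inj_on)
  qed
  define R where "R = perm_map \<tau>"
  define x' where "x' = smap_word [0, 1] (R \<xi>)"
  have two: "[0, 1] \<in> words 2" by (auto simp: words_def)
  have R: "R \<xi> \<in> gasket" using perm_map_gasket[OF \<tau>] w(2) by (auto simp: R_def)
  have x': "x' \<in> cell [0, 1]" using R by (simp add: x'_def cell_def)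
  define B where "B = cball x' (2 ^ n / 4 * d)"
  define V where "V = {v \<in> words n. \<exists>y\<in>gasket. smap_word v y \<in> cball x d}"
  have "\<exists>t\<in>words 2. \<forall>a\<in>alphabet. addr (\<tau> a) t - addr (\<tau> a) [0, 1] = addr a v - addr a w"
    if v: "v \<in> V" for v
  proof -
    obtain y where y: "v \<in> words n" "y \<in> gasket" "dist x (smap_word v y) \<le> d"
      using v by (auto simp: V_def)
    have "\<bar>addr a v - addr a w\<bar> \<le> 1" if a: "a \<in> alphabet" for a
    proof -
      have "\<bar>bary a x - bary a (smap_word v y)\<bar> \<le> 2 / sqrt 3 * d"
        using bary_diff_le[OF a, of x "smap_word v y"] mult_left_mono[OF y(3), of "2 / sqrt 3"]
        by simp
      also have "\<dots> < 2 / sqrt 3 * (sqrt 3 / 2 / 2 ^ n)"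
        using d by (intro mult_strict_left_mono) (auto simp: n_def)
      also have "\<dots> = 1 / 2 ^ n" by simp
      finally have "\<bar>(bary a \<xi> + of_int (addr a w)) / 2 ^ n - (bary a y + of_int (addr a v)) / 2 ^ n\<bar> < 1 / 2 ^ n"
        using bary_smap_word[OF w(1) a] bary_smap_word[OF y(1) a] w(3) by simp
      then have "\<bar>(bary a \<xi> + of_int (addr a w)) - (bary a y + of_int (addr a v))\<bar> < 1"
        by (simp add: diff_divide_distrib[symmetric] abs_divide divide_less_cancel)
      \<comment> \<open>The coordinates of \<open>\<xi>\<close> and \<open>y\<close> lie in [0, 1]
        and so differ by at most 1, which leaves less than 2 for the integer parts.\<close>
      then have "\<bar>of_int (addr a v) - of_int (addr a w)\<bar> < (2::real)"
        using bary_gasket[OF w(2) a] bary_gasket[OF y(2) a] by linarith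
      then show ?thesis by linarith
    qed
    then obtain p q where pq: "(p, q) \<in> {(i, i), (j, i), (l, i), (i, j)}" "offset p q v w"
      using close[OF y(1)] by blast
    \<comment> \<open>\<open>t\<close> lies relative to \<open>[0, 1]\<close> as \<open>v\<close>
      lies relative to \<open>w\<close>, up to the relabelling \<open>\<tau>\<close>.\<close>
    define t where "t = (if p = i \<and> q = i then [0, 1] else if p = j then [0, 0]
        else if p = l then [0, 2] else [1, 0 :: nat])"
    have "t \<in> words 2" by (auto simp: t_def words_def)
    moreover have "\<forall>a\<in>alphabet. addr (\<tau> a) t - addr (\<tau> a) [0, 1] = of_bool (a = p) - of_bool (a = q)"
      unfolding ijl(1) using pq(1) ijl(2-4) by (auto simp: t_def \<tau>_def addr_def)
    ultimately show ?thesis using pq(2) unfolding offset_def by metis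
  qed
  then obtain \<phi> where \<phi>: "\<And>v. v \<in> V \<Longrightarrow> \<phi> v \<in> words 2"
    "\<And>v a. v \<in> V \<Longrightarrow> a \<in> alphabet \<Longrightarrow> addr (\<tau> a) (\<phi> v) - addr (\<tau> a) [0, 1] = addr a v - addr a w"
    by metis
  have inj: "inj_on \<phi> V"
  proof (rule inj_onI)
    fix u v assume uv: "u \<in> V" "v \<in> V" "\<phi> u = \<phi> v"
    show "u = v"
    proof (rule addr_inj)
      fix a assume "a \<in> alphabet"
      then show "addr a u = addr a v" using \<phi>(2)[OF uv(1)] \<phi>(2)[OF uv(2)] uv(3) by fastforce
    qed (use uv in \<open>auto simp: V_def\<close>)
  qed
  have same: "measure M (smap_word v -` cball x d) = measure M (smap_word (\<phi> v) -` B)" if v: "v \<in> V" for v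
  proof -
    \<comment> \<open>Address differences agree and \<open>R\<close> permutes the coordinates, so
      distances to the two centres are proportional; \<open>2 ^ n / 4\<close> is the ratio of the
      cell sizes.\<close>
    have "dist (smap_word (\<phi> v) (R y)) x' = 2 ^ n / 4 * dist (smap_word v y) x" for y
    proof (rule dist_scaled_perm[OF \<tau>])
      fix a assume a: "a \<in> alphabet"
      then have ta: "\<tau> a \<in> alphabet" using \<tau> by (rule bij_betw_apply[rotated])
      have eq: "real_of_int (addr (\<tau> a) (\<phi> v)) - real_of_int (addr (\<tau> a) [0, 1]) =
          real_of_int (addr a v) - real_of_int (addr a w)"
        using \<phi>(2)[OF v a] by (simp flip: of_int_diff)
      have vn: "v \<in> words n" using v by (simp add: V_def)
      have "bary (\<tau> a) (smap_word (\<phi> v) (R y)) - bary (\<tau> a) x' =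
          (bary a y - bary a \<xi> + (of_int (addr (\<tau> a) (\<phi> v)) - of_int (addr (\<tau> a) [0, 1]))) / 4"
        unfolding x'_def R_def bary_smap_word[OF \<phi>(1)[OF v] ta] bary_smap_word[OF two ta]
          bary_perm_map[OF \<tau> a] by (simp add: field_simps)
      also have "\<dots> = 2 ^ n / 4 * (bary a (smap_word v y) - bary a x)"
        unfolding w(3) bary_smap_word[OF w(1) a] bary_smap_word[OF vn a] eq by (simp add: field_simps)
      finally show "bary (\<tau> a) (smap_word (\<phi> v) (R y)) - bary (\<tau> a) x' =
          2 ^ n / 4 * (bary a (smap_word v y) - bary a x)" .
    qed simp
    then have "smap_word (\<phi> v) (R y) \<in> B \<longleftrightarrow> smap_word v y \<in> cball x d" for y
      unfolding B_def mem_cball by (simp add: dist_commute)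
    then have "smap_word v -` cball x d = R -` (smap_word (\<phi> v) -` B)" by auto
    moreover obtain c r where cr: "smap_word (\<phi> v) -` B = cball c r"
      using smap_word_vimage_cball unfolding B_def by blast
    moreover have "measure M (R -` cball c r) = measure M (cball c r)"
    proof -
      have s: "sets M = sets borel" using M by (simp add: self_similar_def)
      have sp: "space M = UNIV" using sets_eq_imp_space_eq[OF s] by simp
      have "R \<in> borel_measurable borel"
        unfolding R_def using continuous_on_perm_map by (rule borel_measurable_continuous_onI)
      then have meas: "R \<in> borel_measurable M"
        using measurable_cong_sets[OF s refl] by blast
      have "measure (distr M borel R) (cball c r) = measure M (R -` cball c r)"
        by (simp add: measure_distr[OF meas] sp)
      moreover have "measure (distr M borel R) (cball c r) = measure M (cball c r)"
        unfolding R_def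
        by (intro antisym self_similar_cball_le M self_similar_perm_map \<tau>)
      ultimately show ?thesis by simp
    qed
    ultimately show ?thesis by simp
  qed
  have "measure M (cball x d) = (\<Sum>v\<in>words n. measure M (smap_word v -` cball x d)) / 3 ^ n"
    by (rule self_similar_words[OF M]) simp
  also have "(\<Sum>v\<in>words n. measure M (smap_word v -` cball x d)) = (\<Sum>v\<in>V. measure M (smap_word v -` cball x d))"
  proof (rule sum.mono_neutral_right)
    show "\<forall>v\<in>words n - V. measure M (smap_word v -` cball x d) = 0"
      by (intro ballI self_similar_null[OF M] smap_word_vimage_borel) (auto simp: V_def)
  qed (auto simp: V_def)
  also have "\<dots> = (\<Sum>v\<in>V. measure M (smap_word (\<phi> v) -` B))" using same by simp
  also have "\<dots> = (\<Sum>t\<in>\<phi> ` V. measure M (smap_word t -` B))"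
    by (simp add: sum.reindex[OF inj])
  also have "\<dots> \<le> (\<Sum>t\<in>words 2. measure M (smap_word t -` B))"
    using \<phi>(1) by (intro sum_mono2) auto
  also have "\<dots> = 9 * measure M B"
    using self_similar_words[OF M, of B 2] by (simp add: B_def)
  finally have "measure M (cball x d) \<le> 9 / 3 ^ n * measure M B" by (simp add: divide_right_mono)
  then show ?thesis using x' unfolding B_def n_def by blast
qed

section \<open>Centred coverings\<close>

text \<open>The centres are taken from \<open>P\<close> rather than from \<open>E\<close>, which makes this monotone and countably
  subadditive in \<open>E\<close>.\<close>

definition centred_content ::
    "real \<Rightarrow> real \<Rightarrow> 'a::euclidean_space set \<Rightarrow> 'a set \<Rightarrow> ennreal" where
  "centred_content s \<delta> P E =
     Inf {(\<Sum>i. ennreal ((2 * d i) powr s)) | (x :: nat \<Rightarrow> 'a) (d :: nat \<Rightarrow> real).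
            (\<forall>i. x i \<in> P \<and> 0 < d i \<and> 2 * d i \<le> \<delta>) \<and> E \<subseteq> (\<Union>i. cball (x i) (d i))}"

lemma centred_premeasure_at_eq: "centred_premeasure_at s \<delta> E = centred_content s \<delta> E E"
  unfolding centred_premeasure_at_def centred_content_def ..

lemma centred_content_le:
  assumes "\<And>i. x i \<in> P" "\<And>i. 0 < d i" "\<And>i. 2 * d i \<le> \<delta>" "E \<subseteq> (\<Union>i. cball (x i) (d i))"
  shows "centred_content s \<delta> P E \<le> (\<Sum>i. ennreal ((2 * d i) powr s))"
  unfolding centred_content_def by (rule Inf_lower) (use assms in blast)

lemma centred_content_mono:
  "E \<subseteq> E' \<Longrightarrow> centred_content s \<delta> P E \<le> centred_content s \<delta> P E'"
  unfolding centred_content_def by (rule Inf_superset_mono) blast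

lemma centred_content_less:
  assumes "centred_content s \<delta> P E < t"
  shows "\<exists>x d. (\<forall>i. x i \<in> P) \<and> (\<forall>i. 0 < d i) \<and> (\<forall>i. 2 * d i \<le> \<delta>) \<and> E \<subseteq> (\<Union>i. cball (x i) (d i)) \<and>
    (\<Sum>i. ennreal ((2 * d i) powr s)) < t"
  using assms unfolding centred_content_def Inf_less_iff by blast

lemma centred_content_UN:
  "centred_content s \<delta> P (\<Union>n. E n) \<le> (\<Sum>n. centred_content s \<delta> P (E n))"
    (is "_ \<le> suminf ?h")
proof (rule ennreal_le_epsilon)
  fix e :: real
  assume fin: "suminf ?h < top" and "0 < e"
  define Q where "Q n x d \<longleftrightarrow> (\<forall>i. x i \<in> P) \<and> (\<forall>i. 0 < d i) \<and> (\<forall>i. 2 * d i \<le> \<delta>) \<and>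
      E n \<subseteq> (\<Union>i. cball (x i) (d i)) \<and>
      (\<Sum>i. ennreal ((2 * d i) powr s)) \<le> ?h n + ennreal (e * (1/2) ^ Suc n)" for n x d
  have "\<exists>x d. Q n x d" for n
  proof -
    have "?h n \<le> suminf ?h" using sum_le_suminf[of ?h "{n}"] by simp
    then have "?h n < top" using fin by (rule le_less_trans)
    then have "?h n < ?h n + ennreal (e * (1/2) ^ Suc n)"
      using \<open>0 < e\<close> ennreal_add_left_cancel_less[of "?h n" 0 "ennreal (e * (1/2) ^ Suc n)"] by simp
    from centred_content_less[OF this] show ?thesis unfolding Q_def by (meson less_imp_le)
  qed
  then obtain x d where "\<And>n. Q n (x n) (d n)" by metis
  then have *: "\<And>n i. x n i \<in> P" "\<And>n i. 0 < d n i" "\<And>n i. 2 * d n i \<le> \<delta>"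
      "\<And>n. E n \<subseteq> (\<Union>i. cball (x n i) (d n i))"
      "\<And>n. (\<Sum>i. ennreal ((2 * d n i) powr s)) \<le> ?h n + ennreal (e * (1/2) ^ Suc n)"
    unfolding Q_def by simp_all
  define X where "X k = (case prod_decode k of (n, i) \<Rightarrow> x n i)" for k
  define D where "D k = (case prod_decode k of (n, i) \<Rightarrow> d n i)" for k
  have "centred_content s \<delta> P (\<Union>n. E n) \<le> (\<Sum>k. ennreal ((2 * D k) powr s))"
  proof (rule centred_content_le)
    show "(\<Union>n. E n) \<subseteq> (\<Union>k. cball (X k) (D k))"
    proof
      fix y assume "y \<in> (\<Union>n. E n)"
      then obtain n i where "y \<in> cball (x n i) (d n i)" using *(4) by blast
      then have "y \<in> cball (X (prod_encode (n, i))) (D (prod_encode (n, i)))"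
        by (simp add: X_def D_def)
      then show "y \<in> (\<Union>k. cball (X k) (D k))" by blast
    qed
  qed (auto simp: X_def D_def * split: prod.split)
  also have "\<dots> = (\<Sum>k. (case prod_decode k of (n, i) \<Rightarrow> ennreal ((2 * d n i) powr s)))"
    unfolding D_def by (intro arg_cong[where f = suminf] ext) (simp split: prod.split)
  also have "\<dots> = (\<Sum>n. \<Sum>i. ennreal ((2 * d n i) powr s))"
    by (rule suminf_ennreal_2dimen[where f = "\<lambda>(n, i). ennreal ((2 * d n i) powr s)"]) simp
  also have "\<dots> \<le> (\<Sum>n. ?h n + ennreal (e * (1/2) ^ Suc n))"
    by (intro suminf_le *) auto
  also have "\<dots> = suminf ?h + (\<Sum>n. ennreal e * ennreal ((1/2) ^ Suc n))"
    using \<open>0 < e\<close> by (subst suminf_add[symmetric])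
      (auto simp del: ennreal_suminf_cmult simp add: ennreal_mult[symmetric])
  also have "\<dots> = suminf ?h + ennreal e"
    unfolding ennreal_suminf_cmult
    by (subst suminf_ennreal_eq[OF zero_le_power power_half_series]) auto
  finally show "centred_content s \<delta> P (\<Union>n. E n) \<le> suminf ?h + ennreal e" .
qed

text \<open>Coverings consist of infinitely many balls of positive radius, so finite ones are padded
  by balls of negligible cost. The radii allot \<open>e * (1/2) ^ Suc i\<close> to ball
  \<open>i\<close>.\<close>

lemma small_radii:
  fixes s \<delta> e :: real
  assumes "0 < s" "0 < \<delta>" "0 < e"
  obtains d where "\<And>i::nat. 0 < d i" "\<And>i. 2 * d i \<le> \<delta>"
    "(\<Sum>i. ennreal ((2 * d i) powr s)) \<le> ennreal e"
proof
  define d where "d i = min \<delta> ((e * (1/2) ^ Suc i) powr (1/s)) / 2" for i :: nat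
  show "0 < d i" "2 * d i \<le> \<delta>" for i
    using assms by (auto simp: d_def)
  have "(2 * d i) powr s \<le> e * (1/2) ^ Suc i" for i
  proof -
    have "(2 * d i) powr s \<le> ((e * (1/2) ^ Suc i) powr (1/s)) powr s"
      using assms by (intro powr_mono2) (auto simp: d_def)
    then show ?thesis using assms by (simp add: powr_powr)
  qed
  then have "(\<Sum>i. ennreal ((2 * d i) powr s)) \<le> (\<Sum>i. ennreal e * ennreal ((1/2) ^ Suc i))"
    using assms by (intro suminf_le) (auto simp: ennreal_mult[symmetric] simp del: power_Suc intro!: ennreal_leI)
  also have "\<dots> = ennreal e"
    unfolding ennreal_suminf_cmult
    by (subst suminf_ennreal_eq[OF zero_le_power power_half_series]) auto
  finally show "(\<Sum>i. ennreal ((2 * d i) powr s)) \<le> ennreal e" .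
qed

lemma centred_content_empty:
  assumes "0 < s" "0 < \<delta>" "P \<noteq> {}"
  shows "centred_content s \<delta> P {} = 0"
proof -
  obtain p where "p \<in> P" using assms by auto
  have "centred_content s \<delta> P {} \<le> 0 + ennreal e" if "e > 0" for e :: real
  proof -
    obtain d where d: "\<And>i::nat. 0 < d i" "\<And>i. 2 * d i \<le> \<delta>"
      "(\<Sum>i. ennreal ((2 * d i) powr s)) \<le> ennreal e"
      using small_radii[OF assms(1,2) \<open>e > 0\<close>] by blast
    then show ?thesis
      using order_trans[OF centred_content_le[of "\<lambda>_. p" P d \<delta> "{}" s] d(3)] \<open>p \<in> P\<close> by simp
  qed
  then have "centred_content s \<delta> P {} \<le> 0" by (rule ennreal_le_epsilon)
  then show ?thesis by simp
qed

lemma centred_content_cball: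
  assumes "0 < s" "p \<in> P" "0 < r" "2 * r \<le> \<delta>"
  shows "centred_content s \<delta> P (cball p r) \<le> ennreal ((2 * r) powr s)"
proof (rule ennreal_le_epsilon)
  fix e :: real assume "0 < e"
  have "0 < \<delta>" using assms by linarith
  obtain d where d: "\<And>i::nat. 0 < d i" "\<And>i. 2 * d i \<le> \<delta>"
      "(\<Sum>i. ennreal ((2 * d i) powr s)) \<le> ennreal e"
    using small_radii[OF assms(1) \<open>0 < \<delta>\<close> \<open>0 < e\<close>] by blast
  define D where "D i = (if i = 0 then r else d i)" for i :: nat
  have "centred_content s \<delta> P (cball p r) \<le> (\<Sum>i. ennreal ((2 * D i) powr s))"
  proof (rule centred_content_le)
    have "cball p r \<subseteq> cball p (D 0)" by (simp add: D_def)
    then show "cball p r \<subseteq> (\<Union>i. cball p (D i))" by blast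
  qed (use assms d in \<open>auto simp: D_def\<close>)
  also have "\<dots> \<le> (\<Sum>i. (if i = 0 then ennreal ((2 * r) powr s) else 0) + ennreal ((2 * d i) powr s))"
    by (intro suminf_le) (auto simp: D_def)
  also have "\<dots> = (\<Sum>i::nat. if i = 0 then ennreal ((2 * r) powr s) else 0)
      + (\<Sum>i. ennreal ((2 * d i) powr s))"
    by (intro suminf_add[symmetric]) auto
  also have "(\<Sum>i::nat. if i = 0 then ennreal ((2 * r) powr s) else 0) = ennreal ((2 * r) powr s)"
    by (subst suminf_finite[of "{0}"]) auto
  finally show "centred_content s \<delta> P (cball p r) \<le> ennreal ((2 * r) powr s) + ennreal e"
    using d(3) by (meson add_left_mono order_trans)
qed

text \<open>Allows any countable index set, finite and empty ones included, in place of sequences.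
  Numbers outside the range of \<open>to_nat_on K\<close> receive the empty set, which has content
  0.\<close>

lemma centred_content_countable:
  fixes a :: "'i \<Rightarrow> 'a::euclidean_space"
  assumes K: "countable K" and s: "0 < s" "0 < \<delta>" "P \<noteq> {}" "0 \<le> c"
    and ar: "\<And>i. i \<in> K \<Longrightarrow> a i \<in> P" "\<And>i. i \<in> K \<Longrightarrow> 0 < r i" "\<And>i. i \<in> K \<Longrightarrow> 2 * r i \<le> \<delta>"
    and E: "E \<subseteq> (\<Union>i\<in>K. cball (a i) (r i))"
    and c: "\<And>J. finite J \<Longrightarrow> J \<subseteq> K \<Longrightarrow> (\<Sum>i\<in>J. (2 * r i) powr s) \<le> c"
  shows "centred_content s \<delta> P E \<le> ennreal c"
proof -
  define B where "B n = (\<Union>i\<in>{i\<in>K. to_nat_on K i = n}. cball (a i) (r i))" for n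
  define g where "g n = (if n \<in> to_nat_on K ` K then (2 * r (inv_into K (to_nat_on K) n)) powr s else 0)" for n
  have inj: "inj_on (to_nat_on K) K" using K by (rule inj_on_to_nat_on)
  have "centred_content s \<delta> P E \<le> centred_content s \<delta> P (\<Union>n. B n)"
    by (rule centred_content_mono) (use E in \<open>unfold B_def, blast\<close>)
  also have "\<dots> \<le> (\<Sum>n. centred_content s \<delta> P (B n))"
    by (rule centred_content_UN)
  also have "\<dots> \<le> (\<Sum>n. ennreal (g n))"
  proof (intro suminf_le allI)
    fix n
    show "centred_content s \<delta> P (B n) \<le> ennreal (g n)"
    proof (cases "n \<in> to_nat_on K ` K")
      case True
      then obtain i where i: "i \<in> K" "n = to_nat_on K i" by auto
      have "{j\<in>K. to_nat_on K j = n} = {i}" using i inj by (auto simp: inj_on_def)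
      then have "B n = cball (a i) (r i)" by (simp add: B_def)
      moreover have "g n = (2 * r i) powr s"
        using i inj by (simp add: g_def)
      ultimately show ?thesis using centred_content_cball[OF s(1), of "a i" P "r i" \<delta>] ar i by simp
    next
      case False
      then have "B n = {}" by (auto simp: B_def)
      then show ?thesis using centred_content_empty[OF s(1-3)] by simp
    qed
  qed auto
  also have "\<dots> \<le> ennreal c"
  proof (rule suminf_le_const)
    fix N
    define J where "J = {i\<in>K. to_nat_on K i < N}"
    have "finite (to_nat_on K ` J)" by (rule finite_subset[of _ "{..<N}"]) (auto simp: J_def)
    then have J: "finite J" using inj by (auto simp: J_def inj_on_def intro: finite_imageD)
    have "(\<Sum>n<N. ennreal (g n)) = ennreal (\<Sum>n<N. g n)"
      by (intro sum_ennreal) (auto simp: g_def)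
    also have "(\<Sum>n<N. g n) = (\<Sum>n\<in>to_nat_on K ` J. g n)"
      by (rule sum.mono_neutral_right) (auto simp: J_def g_def)
    also have "\<dots> = (\<Sum>i\<in>J. (2 * r i) powr s)"
      using inj by (subst sum.reindex) (auto simp: J_def g_def inj_on_def intro!: sum.cong)
    also have "\<dots> \<le> c" using c[OF J] by (auto simp: J_def)
    finally show "(\<Sum>n<N. ennreal (g n)) \<le> ennreal c" by (simp add: ennreal_leI)
  qed auto
  finally show ?thesis .
qed

text \<open>Finitely many of the selected disjoint balls carry all but \<open>e'\<close> of the total cost; the others are
  enlarged by the factor 5 to cover the rest of \<open>E\<close>.\<close>

lemma centred_content_vitali:
  fixes M :: "'a::euclidean_space measure"
  assumes M: "prob_space M" "sets M = sets borel"
    and s: "0 < s" "0 < \<delta>" "0 \<le> c" "P \<noteq> {}" "E \<subseteq> P"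
    and fine: "\<And>x e. x \<in> E \<Longrightarrow> 0 < e \<Longrightarrow>
      \<exists>d. 0 < d \<and> d < e \<and> (2 * d) powr s \<le> c * measure M (cball x d)"
  shows "centred_content s \<delta> P E \<le> ennreal c"
proof (rule ennreal_le_epsilon)
  interpret prob_space M by fact
  fix e :: real assume "0 < e"
  \<comment> \<open>Fivefold radii multiply costs by \<open>5 powr s\<close>, so a tail of cost at
    most \<open>e'\<close> grows to at most \<open>e\<close>.\<close>
  define e' where "e' = e / 5 powr s"
  have e': "e' > 0" "5 powr s * e' = e" using \<open>0 < e\<close> by (auto simp: e'_def)
  \<comment> \<open>The condition \<open>10 * d \<le> \<delta>\<close> keeps the diameter admissible
    after the fivefold enlargement.\<close>
  define K where "K = {(x, d). x \<in> E \<and> 0 < d \<and> 10 * d \<le> \<delta> \<and> (2 * d) powr s \<le> c * measure M (cball x d)}"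
  have K0: "0 < snd i \<and> snd i \<le> \<delta>" if "i \<in> K" for i
    using that s by (auto simp: K_def)
  obtain C where C: "countable C" "C \<subseteq> K"
    "pairwise (\<lambda>i j. disjnt (cball (fst i) (snd i)) (cball (fst j) (snd j))) C"
    "\<And>i. i \<in> K \<Longrightarrow> \<exists>j. j \<in> C \<and> \<not> disjnt (cball (fst i) (snd i)) (cball (fst j) (snd j)) \<and>
                        cball (fst i) (snd i) \<subseteq> ball (fst j) (5 * snd j)"
    by (rule Vitali_covering_lemma_cballs_balls[of K snd \<delta> fst, OF K0]) (blast intro: that)+
  define g where "g J = (\<Sum>i\<in>J. (2 * snd i) powr s)" for J :: "('a \<times> real) set"
  \<comment> \<open>The selected balls are disjoint, so their total mass is at most 1 and their
    total cost at most \<open>c\<close>.\<close>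
  have g: "g J \<le> c" if "finite J" "J \<subseteq> C" for J
  proof -
    have "g J \<le> (\<Sum>i\<in>J. c * measure M (cball (fst i) (snd i)))"
      unfolding g_def using that C(2) by (intro sum_mono) (auto simp: K_def)
    also have "\<dots> = c * (\<Sum>i\<in>J. measure M (cball (fst i) (snd i)))"
      by (simp add: sum_distrib_left)
    also have "(\<Sum>i\<in>J. measure M (cball (fst i) (snd i))) = measure M (\<Union>i\<in>J. cball (fst i) (snd i))"
    proof (rule finite_measure_finite_Union[symmetric])
      show "disjoint_family_on (\<lambda>i. cball (fst i) (snd i)) J"
        using C(3) that(2) unfolding disjoint_family_on_def pairwise_def disjnt_def by blast
    qed (use that M in auto)
    also have "c * \<dots> \<le> c * 1" using s by (intro mult_left_mono) auto
    finally show ?thesis by simp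
  qed
  define G where "G = g ` {J. finite J \<and> J \<subseteq> C}"
  have "G \<noteq> {}" unfolding G_def by blast
  moreover have bdd: "bdd_above G" unfolding G_def using g by (intro bdd_aboveI[of _ c]) auto
  ultimately have "\<exists>y\<in>G. Sup G - e' < y" using e' by (simp add: less_cSup_iff[symmetric])
  then obtain J0 where J0: "finite J0" "J0 \<subseteq> C" "Sup G - e' < g J0"
    unfolding G_def by blast
  have tail: "g J \<le> e'" if "finite J" "J \<subseteq> C - J0" for J
  proof -
    have "g (J0 \<union> J) = g J0 + g J"
      unfolding g_def using that J0 by (intro sum.union_disjoint) auto
    moreover have "g (J0 \<union> J) \<le> Sup G"
      using that J0 by (intro cSup_upper bdd) (auto simp: G_def)
    ultimately show ?thesis using J0 by simp
  qed
  define r where "r i = (if i \<in> J0 then snd i else 5 * snd i)" for i :: "'a \<times> real"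
  have "centred_content s \<delta> P E \<le> ennreal (c + e)"
  proof (rule centred_content_countable[OF C(1) s(1,2,4)])
    show "0 \<le> c + e" using s \<open>0 < e\<close> by simp
    fix i assume "i \<in> C"
    then have "i \<in> K" using C(2) by blast
    then show "fst i \<in> P" "0 < r i" "2 * r i \<le> \<delta>"
      using s by (auto simp: K_def r_def)
  next
    show "E \<subseteq> (\<Union>i\<in>C. cball (fst i) (r i))"
    proof
      fix x assume "x \<in> E"
      let ?U = "\<Union>i\<in>J0. cball (fst i) (snd i)"
      show "x \<in> (\<Union>i\<in>C. cball (fst i) (r i))"
      proof (cases "x \<in> ?U")
        case True
        then obtain i where "i \<in> J0" "x \<in> cball (fst i) (snd i)" by blast
        then have "i \<in> C" "x \<in> cball (fst i) (r i)" using J0 by (auto simp: r_def)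
        then show ?thesis by blast
      next
        case False
        \<comment> \<open>A point outside these finitely many closed balls has an admissible ball
          that misses them all. The selected ball that it meets is therefore in the tail, and its
          enlargement contains the point.\<close>
        have "closed ?U" using J0 by (intro closed_UN) auto
        then have "open (- ?U)" by (rule open_Compl)
        then obtain t where t: "t > 0" "ball x t \<subseteq> - ?U"
          using False unfolding open_contains_ball by blast
        have "0 < min t (\<delta> / 10)" using t s by simp
        then obtain d where d: "0 < d" "d < min t (\<delta> / 10)" "(2 * d) powr s \<le> c * measure M (cball x d)"
          using fine[OF \<open>x \<in> E\<close>] by blast
        then have "(x, d) \<in> K" using \<open>x \<in> E\<close> by (auto simp: K_def)
        from C(4)[OF this] obtain j where j: "j \<in> C" "\<not> disjnt (cball x d) (cball (fst j) (snd j))"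
          "cball x d \<subseteq> ball (fst j) (5 * snd j)" by auto
        have "cball x d \<subseteq> - ?U" using d t by force
        then have "j \<notin> J0" using j(2) by (auto simp: disjnt_def)
        moreover have "x \<in> ball (fst j) (5 * snd j)" using j(3) d by (meson centre_in_cball less_imp_le subsetD)
        ultimately have "x \<in> cball (fst j) (r j)" by (simp add: r_def)
        then show ?thesis using j(1) by blast
      qed
    qed
  next
    fix J assume J: "finite J" "J \<subseteq> C"
    have "(\<Sum>i\<in>J. (2 * r i) powr s) = (\<Sum>i\<in>J \<inter> J0. (2 * r i) powr s) + (\<Sum>i\<in>J - J0. (2 * r i) powr s)"
      using J by (metis add.commute sum.Int_Diff)
    also have "(\<Sum>i\<in>J \<inter> J0. (2 * r i) powr s) = g (J \<inter> J0)"
      unfolding g_def by (intro sum.cong) (auto simp: r_def)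
    also have "(\<Sum>i\<in>J - J0. (2 * r i) powr s) = 5 powr s * g (J - J0)"
      unfolding g_def sum_distrib_left
    proof (intro sum.cong refl)
      fix i assume "i \<in> J - J0"
      then have "r i = 5 * snd i" "i \<in> K" using J C(2) by (auto simp: r_def)
      moreover from this have "snd i > 0" using K0 by blast
      ultimately show "(2 * r i) powr s = 5 powr s * (2 * snd i) powr s"
        by (simp add: powr_mult[symmetric])
    qed
    also have "g (J \<inter> J0) + 5 powr s * g (J - J0) \<le> c + 5 powr s * e'"
      using J by (intro add_mono mult_left_mono g tail) auto
    finally show "(\<Sum>i\<in>J. (2 * r i) powr s) \<le> c + e" using e' by simp
  qed
  then show "centred_content s \<delta> P E \<le> ennreal c + ennreal e"
    using s \<open>0 < e\<close> by (simp add: ennreal_plus)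
qed

section \<open>The upper bound\<close>

lemma dim_S_pos: "0 < dim_S"
  by (simp add: dim_S_def)

lemma two_powr_dim_S: "2 powr dim_S = 3"
  by (simp add: dim_S_def powr_def)

lemma powr_dim_S_scale: "0 \<le> t \<Longrightarrow> (t / 2 ^ k) powr dim_S = t powr dim_S / 3 ^ k"
proof (induction k)
  case (Suc k)
  have "(t / 2 ^ Suc k) powr dim_S = (t / 2 ^ k / 2) powr dim_S"
    by (simp add: mult.commute)
  also have "\<dots> = (t / 2 ^ k) powr dim_S / 3"
    using Suc.prems by (subst powr_divide) (auto simp: two_powr_dim_S)
  finally show ?case using Suc by simp
qed simp

lemma self_similar_cell_ge:
  assumes M: "self_similar M" and w: "w \<in> words k" and B: "B \<in> sets borel"
  shows "measure M (smap_word w -` B) / 3 ^ k \<le> measure M B"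
  unfolding self_similar_words[OF M B, of k]
  using w by (intro divide_right_mono member_le_sum) auto

lemma self_similar_cball_scale:
  assumes M: "self_similar M" and w: "w \<in> words k"
  shows "measure M (cball x d) / 3 ^ k \<le> measure M (cball (smap_word w x) (d / 2 ^ k))"
proof -
  have "smap_word w -` cball (smap_word w x) (d / 2 ^ k) = cball x d"
    using w by (auto simp: dist_smap_word length_words divide_le_cancel)
  then show ?thesis
    using self_similar_cell_ge[OF M w, of "cball (smap_word w x) (d / 2 ^ k)"] by simp
qed

lemma self_similar_cball_pos:
  assumes M: "self_similar M" and x: "x \<in> gasket" and d: "0 < d"
  shows "0 < measure M (cball x d)"
proof -
  obtain k where "1 / d < 2 ^ k" using real_arch_pow[of 2 "1 / d"] by auto
  then have k: "1 / 2 ^ k \<le> d" using d by (simp add: field_simps)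
  obtain w y where w: "w \<in> words k" "y \<in> gasket" "x = smap_word w y"
    using gasket_wordE[OF x] .
  have "gasket \<subseteq> smap_word w -` cball x d"
    using dist_cell_le[OF w(2) _ w(1)] k w(3) by force
  then have "measure M (smap_word w -` cball x d) = 1"
    by (intro self_similar_full[OF M] smap_word_vimage_borel) auto
  then have "1 / 3 ^ k \<le> measure M (cball x d)"
    using self_similar_cell_ge[OF M w(1), of "cball x d"] by simp
  then show ?thesis by (rule less_le_trans[rotated]) simp
qed

section \<open>Points whose coding avoids a fixed word\<close>

fun avoiding_words :: "nat \<Rightarrow> nat list \<Rightarrow> nat \<Rightarrow> nat list set" where
  "avoiding_words m \<tau> 0 = words m"
| "avoiding_words m \<tau> (Suc n) =
     (\<lambda>(u, v). u @ v) ` (avoiding_words m \<tau> n \<times> (words (length \<tau>) - {\<tau>}))"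

lemma avoiding_words_subset: "avoiding_words m \<tau> n \<subseteq> words (m + n * length \<tau>)"
proof (induction n)
  case (Suc n)
  show ?case
  proof
    fix w assume "w \<in> avoiding_words m \<tau> (Suc n)"
    then obtain u v where "w = u @ v" "u \<in> avoiding_words m \<tau> n" "v \<in> words (length \<tau>)" by auto
    then show "w \<in> words (m + Suc n * length \<tau>)"
      using Suc words_append[of u "m + n * length \<tau>" v "length \<tau>"] by (auto simp: add_ac)
  qed
qed simp

lemma finite_avoiding_words: "finite (avoiding_words m \<tau> n)"
  using avoiding_words_subset finite_words by (rule finite_subset)

lemma card_avoiding_words:
  assumes "\<tau> \<in> words (length \<tau>)"
  shows "real (card (avoiding_words m \<tau> n)) \<le> 3 ^ m * (3 ^ length \<tau> - 1) ^ n"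
proof (induction n)
  case 0
  then show ?case by (simp add: card_words)
next
  case (Suc n)
  let ?L = "length \<tau>"
  have "card (avoiding_words m \<tau> (Suc n)) \<le> card (avoiding_words m \<tau> n \<times> (words ?L - {\<tau>}))"
    unfolding avoiding_words.simps
    by (rule card_image_le) (simp add: finite_avoiding_words)
  also have "\<dots> = card (avoiding_words m \<tau> n) * (3 ^ ?L - 1)"
    using assms by (simp add: card_cartesian_product card_words)
  finally have "real (card (avoiding_words m \<tau> (Suc n)))
      \<le> real (card (avoiding_words m \<tau> n) * (3 ^ ?L - 1))"
    by (rule of_nat_mono)
  also have "\<dots> = real (card (avoiding_words m \<tau> n)) * (3 ^ ?L - 1)"
    by (simp add: of_nat_diff)
  also have "\<dots> \<le> 3 ^ m * (3 ^ ?L - 1) ^ n * (3 ^ ?L - 1)"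
    by (intro mult_right_mono Suc) simp
  finally show ?case by (simp add: mult_ac)
qed

text \<open>Stated through cells, so that every coding of a point is taken into account, also where
  a point has two.\<close>

definition avoiding_set :: "nat \<Rightarrow> nat list \<Rightarrow> (real^2) set" where
  "avoiding_set m \<tau> =
     {x \<in> gasket. \<forall>k\<ge>m. \<forall>w\<in>words k. x \<notin> smap_word w ` smap_word \<tau> ` gasket}"

text \<open>Codings are extended block by block: each block follows at least \<open>m\<close>
  letters and hence cannot be \<open>\<tau>\<close>.\<close>

lemma avoiding_set_cover:
  assumes "x \<in> avoiding_set m \<tau>"
  shows "\<exists>w\<in>avoiding_words m \<tau> n. x \<in> smap_word w ` gasket"
proof (induction n)
  case 0
  have "x \<in> gasket" using assms by (simp add: avoiding_set_def)
  then show ?case using gasket_wordE[of x m] by (metis avoiding_words.simps(1) imageI)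
next
  case (Suc n)
  then obtain w y where w: "w \<in> avoiding_words m \<tau> n" "y \<in> gasket" "x = smap_word w y" by auto
  obtain v z where v: "v \<in> words (length \<tau>)" "z \<in> gasket" "y = smap_word v z"
    using gasket_wordE[OF w(2)] .
  have "w \<in> words (m + n * length \<tau>)" using w(1) avoiding_words_subset by blast
  then have "v \<noteq> \<tau>"
    using assms w v unfolding avoiding_set_def
    by (metis (mono_tags, lifting) imageI le_add1 mem_Collect_eq)
  then have "w @ v \<in> avoiding_words m \<tau> (Suc n)" using w v by auto
  moreover have "x = smap_word (w @ v) z" by (simp add: smap_word_append w v)
  ultimately show ?case using v(2) by blast
qed

text \<open>At most \<open>3 ^ m * (3 ^ L - 1) ^ n\<close> cells of level \<open>m + n * L\<close>
  cover \<open>E\<close>, each at cost \<open>3 / 3 ^ (m + n * L)\<close>. The total is at most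
  \<open>3 * q ^ n\<close>, which tends to 0.\<close>

lemma centred_content_avoiding:
  assumes \<tau>: "\<tau> \<in> words L" "L \<ge> 1" and \<delta>: "0 < \<delta>" and E: "E \<subseteq> avoiding_set m \<tau>" "E \<subseteq> P" "P \<noteq> {}"
  shows "centred_content dim_S \<delta> P E = 0"
proof -
  have L: "length \<tau> = L" using \<tau> by (simp add: length_words)
  define q :: real where "q = (3 ^ L - 1) / 3 ^ L"
  have q: "0 \<le> q" "q < 1" by (auto simp: q_def)
  have le: "centred_content dim_S \<delta> P E \<le> ennreal (3 * q ^ n)" if n: "2 / 2 ^ n \<le> \<delta>" for n
  proof -
    define K where "K = {w \<in> avoiding_words m \<tau> n. smap_word w ` gasket \<inter> E \<noteq> {}}"
    define a where "a w = (SOME x. x \<in> smap_word w ` gasket \<inter> E)" for w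
    \<comment> \<open>This bounds the diameter of the cell, so a ball about any of its points covers
      it; the centre can thus be taken in \<open>E\<close>.\<close>
    define r :: "nat list \<Rightarrow> real" where "r w = 1 / 2 ^ (m + n * L)" for w
    have a: "a w \<in> smap_word w ` gasket \<inter> E" if "w \<in> K" for w
    proof -
      have "\<exists>x. x \<in> smap_word w ` gasket \<inter> E" using that unfolding K_def by blast
      then show ?thesis unfolding a_def by (rule someI_ex)
    qed
    have K: "K \<subseteq> words (m + n * L)" using avoiding_words_subset[of m \<tau> n] L by (auto simp: K_def)
    have finK: "finite K" using finite_avoiding_words by (simp add: K_def)
    have rs: "(2 * r w) powr dim_S = 3 / 3 ^ (m + n * L)" for w
      using powr_dim_S_scale[of 2 "m + n * L"] by (simp add: r_def two_powr_dim_S)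
    have sum: "(\<Sum>w\<in>J. (2 * r w) powr dim_S) \<le> 3 * q ^ n" if "J \<subseteq> K" for J
    proof -
      have "real (card J) \<le> real (card (avoiding_words m \<tau> n))"
        using that by (intro of_nat_mono card_mono finite_avoiding_words) (auto simp: K_def)
      also have "\<dots> \<le> 3 ^ m * (3 ^ L - 1) ^ n"
        using card_avoiding_words[of \<tau> m n] \<tau> L by simp
      finally have "real (card J) * (3 / 3 ^ (m + n * L)) \<le> 3 ^ m * (3 ^ L - 1) ^ n * (3 / 3 ^ (m + n * L))"
        by (rule mult_right_mono) simp
      also have "\<dots> = 3 * q ^ n"
        by (simp add: q_def power_divide power_add power_mult[symmetric] mult.commute[of L n])
      finally show ?thesis by (simp add: rs)
    qed
    show ?thesis
    proof (rule centred_content_countable[where K = K and a = a and r = r])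
      fix w assume "w \<in> K"
      then show "a w \<in> P" using a E by blast
      show "0 < r w" by (simp add: r_def)
      have "(2::real) ^ n \<le> 2 ^ (m + n * L)" using \<tau> by (intro power_increasing) (auto simp: trans_le_add2)
      then have "2 / 2 ^ (m + n * L) \<le> 2 / (2::real) ^ n" by (intro divide_left_mono) auto
      then show "2 * r w \<le> \<delta>" using n by (simp add: r_def)
    next
      show "E \<subseteq> (\<Union>w\<in>K. cball (a w) (r w))"
      proof
        fix x assume x: "x \<in> E"
        then obtain w y where w: "w \<in> avoiding_words m \<tau> n" "y \<in> gasket" "x = smap_word w y"
          using avoiding_set_cover[of x m \<tau> n] E by blast
        then have wK: "w \<in> K" using x by (auto simp: K_def)
        then obtain z where z: "z \<in> gasket" "a w = smap_word w z" using a by blast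
        have "dist (a w) x \<le> r w"
          unfolding z(2) w(3) r_def using wK K z w by (intro dist_cell_le) auto
        then show "x \<in> (\<Union>w\<in>K. cball (a w) (r w))" using wK by auto
      qed
    qed (use finK \<delta> E dim_S_pos q sum in \<open>auto intro: countable_finite\<close>)
  qed
  have "(\<lambda>n. 2 / 2 ^ n :: real) \<longlonglongrightarrow> 0" by (rule LIMSEQ_divide_realpow_zero) simp
  then have "eventually (\<lambda>n. 2 / 2 ^ n < \<delta>) sequentially" using \<delta> by (rule order_tendstoD)
  then have ev: "eventually (\<lambda>n. centred_content dim_S \<delta> P E \<le> ennreal (3 * q ^ n)) sequentially"
    by eventually_elim (simp add: le)
  have "(\<lambda>n. 3 * q ^ n) \<longlonglongrightarrow> 3 * 0"
    by (intro tendsto_mult tendsto_const LIMSEQ_realpow_zero q)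
  then have "(\<lambda>n. ennreal (3 * q ^ n)) \<longlonglongrightarrow> ennreal (3 * 0)" by (rule tendsto_ennrealI)
  from tendsto_lowerbound[OF this ev] show ?thesis by simp
qed

lemma centred_premeasure_at_gasket_le:
  assumes M: "self_similar M" and x0: "x0 \<in> gasket" and d0: "0 < d0"
    and G: "G \<subseteq> gasket" "G \<noteq> {}" and \<delta>: "0 < \<delta>" and \<eta>: "0 < \<eta>"
  shows "centred_premeasure_at dim_S \<delta> G
    \<le> ennreal ((2 * (d0 * (1 + \<eta>))) powr dim_S / measure M (cball x0 d0))"
proof -
  define m0 where "m0 = measure M (cball x0 d0)"
  have m0: "m0 > 0" unfolding m0_def by (rule self_similar_cball_pos[OF M x0 d0])
  define c where "c = (2 * (d0 * (1 + \<eta>))) powr dim_S / m0"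
  have c: "c \<ge> 0" using m0 by (simp add: c_def)
  have ed: "0 < \<eta> * d0" using \<eta> d0 by simp
  obtain L0 where L0: "1 / (\<eta> * d0) < 2 ^ L0" using real_arch_pow[of 2 "1 / (\<eta> * d0)"] by auto
  \<comment> \<open>Cells of level \<open>L\<close> have diameter at most
    \<open>\<eta> * d0\<close>, and \<open>\<tau>\<close> will code one containing
    \<open>x0\<close>. The successor secures \<open>L \<ge> 1\<close> for
    \<open>centred_content_avoiding\<close>.\<close>
  define L where "L = Suc L0"
  have "(2::real) ^ L0 \<le> 2 ^ L" by (simp add: L_def)
  then have "1 / (\<eta> * d0) < 2 ^ L" using L0 by linarith
  then have L: "1 / 2 ^ L \<le> \<eta> * d0" using ed by (simp add: field_simps)
  obtain \<tau> y0 where \<tau>: "\<tau> \<in> words L" "y0 \<in> gasket" "x0 = smap_word \<tau> y0"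
    using gasket_wordE[OF x0] .
  \<comment> \<open>\<open>E 0\<close> holds the points lying in cells of \<open>w @ \<tau>\<close>
    for arbitrarily long \<open>w\<close>, treated by the Vitali lemma; the other parts have content
    0.\<close>
  define E where "E n = (case n of 0 \<Rightarrow> G - (\<Union>m. avoiding_set m \<tau>) | Suc m \<Rightarrow> G \<inter> avoiding_set m \<tau>)" for n
  have good: "centred_content dim_S \<delta> G (E 0) \<le> ennreal c"
  proof (rule centred_content_vitali[where M = M])
    show "prob_space M" "sets M = sets borel" using M by (auto simp: self_similar_def)
    fix e :: real and x' :: "real^2"
    assume x: "x' \<in> E 0" and e: "0 < e"
    let ?D = "d0 * (1 + \<eta>)"
    have D: "?D > 0" using d0 \<eta> by simp
    obtain m where m: "?D / e < 2 ^ m" using real_arch_pow[of 2 "?D / e"] by auto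
    have "x' \<in> gasket" "x' \<notin> avoiding_set m \<tau>" using x G by (auto simp: E_def)
    then obtain k w z where k: "k \<ge> m" "w \<in> words k" "z \<in> gasket" "x' = smap_word w (smap_word \<tau> z)"
      by (auto simp: avoiding_set_def)
    \<comment> \<open>Both points lie in the cell of \<open>w @ \<tau>\<close>. The slack
      \<open>\<eta>\<close> in the radius pays for moving the centre from one to the other.\<close>
    have "dist x' (smap_word w x0) = dist (smap_word \<tau> z) (smap_word \<tau> y0) / 2 ^ k"
      using k \<tau> by (simp add: dist_smap_word length_words)
    also have "\<dots> \<le> \<eta> * d0 / 2 ^ k"
      using dist_cell_le[OF k(3) \<tau>(2,1)] L by (intro divide_right_mono) auto
    finally have near: "dist x' (smap_word w x0) \<le> \<eta> * d0 / 2 ^ k" .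
    have D_eq: "?D / 2 ^ k = \<eta> * d0 / 2 ^ k + d0 / 2 ^ k"
      by (simp add: add_divide_distrib[symmetric] algebra_simps)
    have "cball (smap_word w x0) (d0 / 2 ^ k) \<subseteq> cball x' (?D / 2 ^ k)"
    proof
      fix y assume "y \<in> cball (smap_word w x0) (d0 / 2 ^ k)"
      then have "dist (smap_word w x0) y \<le> d0 / 2 ^ k" by simp
      then have "dist x' y \<le> ?D / 2 ^ k"
        using near dist_triangle[of x' y "smap_word w x0"] unfolding D_eq by linarith
      then show "y \<in> cball x' (?D / 2 ^ k)" by simp
    qed
    then have "measure M (cball (smap_word w x0) (d0 / 2 ^ k)) \<le> measure M (cball x' (?D / 2 ^ k))"
      using M by (intro finite_measure.finite_measure_mono)
        (auto simp: self_similar_def prob_space_def)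
    with self_similar_cball_scale[OF M k(2), of x0 d0]
    have "m0 / 3 ^ k \<le> measure M (cball x' (?D / 2 ^ k))" by (simp add: m0_def)
    then have "c * (m0 / 3 ^ k) \<le> c * measure M (cball x' (?D / 2 ^ k))"
      using c by (rule mult_left_mono)
    moreover have "c * (m0 / 3 ^ k) = (2 * (?D / 2 ^ k)) powr dim_S"
      using m0 D powr_dim_S_scale[of "2 * ?D" k] by (simp add: c_def)
    moreover have "?D / 2 ^ k < e"
    proof -
      have "?D < e * 2 ^ m" using m e by (simp add: field_simps)
      also have "\<dots> \<le> e * 2 ^ k" using e k(1) by (intro mult_left_mono power_increasing) auto
      finally show ?thesis by (simp add: field_simps)
    qed
    ultimately show "\<exists>d>0. d < e \<and> (2 * d) powr dim_S \<le> c * measure M (cball x' d)"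
      using D by (intro exI[of _ "?D / 2 ^ k"]) simp
  qed (use dim_S_pos \<delta> c G in \<open>auto simp: E_def\<close>)
  have bad: "centred_content dim_S \<delta> G (E (Suc m)) = 0" for m
    using G by (intro centred_content_avoiding[OF \<tau>(1) _ \<delta>, of _ m]) (auto simp: E_def L_def)
  have "centred_premeasure_at dim_S \<delta> G = centred_content dim_S \<delta> G G"
    by (rule centred_premeasure_at_eq)
  also have "\<dots> \<le> centred_content dim_S \<delta> G (\<Union>n. E n)"
  proof (rule centred_content_mono, rule subsetI)
    fix x assume x: "x \<in> G"
    show "x \<in> (\<Union>n. E n)"
    proof (cases "\<exists>m. x \<in> avoiding_set m \<tau>")
      case True
      then obtain m where "x \<in> E (Suc m)" using x by (auto simp: E_def)
      then show ?thesis by blast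
    next
      case False
      then have "x \<in> E 0" using x by (auto simp: E_def)
      then show ?thesis by blast
    qed
  qed
  also have "\<dots> \<le> (\<Sum>n. centred_content dim_S \<delta> G (E n))" by (rule centred_content_UN)
  also have "\<dots> = centred_content dim_S \<delta> G (E 0)"
    using bad by (subst suminf_finite[of "{0}"]) (auto simp: gr0_conv_Suc)
  also note good
  finally show ?thesis by (simp add: c_def m0_def)
qed

text \<open>The preceding bound holds for every non-empty subset \<open>G\<close>, so it survives
  the supremum. First \<open>\<delta>\<close> tends to 0, then \<open>\<eta>\<close> along the
  sequence \<open>1 / real (Suc n)\<close>.\<close>

lemma centred_Hausdorff_gasket_le:
  assumes M: "self_similar M" and x0: "x0 \<in> gasket" and d0: "0 < d0"
  shows "centred_Hausdorff dim_S gasket \<le> ennreal ((2 * d0) powr dim_S / measure M (cball x0 d0))"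
  unfolding centred_Hausdorff_def
proof (rule Sup_least)
  fix t assume "t \<in> {centred_premeasure dim_S G |G. G \<subseteq> gasket \<and> closed G}"
  then obtain G where G: "t = centred_premeasure dim_S G" "G \<subseteq> gasket" by auto
  show "t \<le> ennreal ((2 * d0) powr dim_S / measure M (cball x0 d0))"
  proof (cases "G = {}")
    case True
    then show ?thesis using G by (simp add: centred_premeasure_def)
  next
    case False
    let ?c = "\<lambda>\<eta>. (2 * (d0 * (1 + \<eta>))) powr dim_S / measure M (cball x0 d0)"
    have le: "t \<le> ennreal (?c \<eta>)" if "\<eta> > 0" for \<eta>
      unfolding G(1)
    proof (rule tendsto_upperbound[OF centred_premeasure_at_tendsto[OF False]])
      show "\<forall>\<^sub>F \<delta> in at_right 0. centred_premeasure_at dim_S \<delta> G \<le> ennreal (?c \<eta>)"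
        using eventually_at_right_less[of 0]
        by eventually_elim (rule centred_premeasure_at_gasket_le[OF M x0 d0 G(2) False _ that])
    qed simp
    have pos: "measure M (cball x0 d0) > 0" by (rule self_similar_cball_pos[OF M x0 d0])
    have "(\<lambda>n. ?c (1 / real (Suc n))) \<longlonglongrightarrow> (2 * (d0 * (1 + 0))) powr dim_S / measure M (cball x0 d0)"
      using d0 pos
      by (intro tendsto_divide tendsto_powr tendsto_mult tendsto_add tendsto_const
          lim_1_over_n[THEN LIMSEQ_Suc]) auto
    moreover have "\<forall>\<^sub>F n in sequentially. t \<le> ennreal (?c (1 / real (Suc n)))"
      by (intro always_eventually allI le) simp
    ultimately have "t \<le> ennreal ((2 * (d0 * (1 + 0))) powr dim_S / measure M (cball x0 d0))"
      using tendsto_lowerbound[OF tendsto_ennrealI] sequentially_bot by blast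
    then show ?thesis by simp
  qed
qed

section \<open>The lower bound and convergence\<close>

text \<open>The radii in \<open>bound\<close> span a factor of 2, so magnification by a power of 2
  brings \<open>d\<close> among them. Under \<open>ball_reduction\<close> the mass bound and
  \<open>(2 * d) powr dim_S\<close> scale by the same power of 3.\<close>

lemma self_similar_ball_bound:
  assumes M: "self_similar M" and t: "0 \<le> t"
    and bound: "\<And>x d. x \<in> cell [0, 1] \<Longrightarrow> sqrt 3 / 16 \<le> d \<Longrightarrow> d < sqrt 3 / 8 \<Longrightarrow>
      t * measure M (cball x d) \<le> (2 * d) powr dim_S"
    and x: "x \<in> gasket" and d: "0 < d" "d < sqrt 3 / 8"
  shows "t * measure M (cball x d) \<le> (2 * d) powr dim_S"
proof -
  \<comment> \<open>The least such \<open>k\<close> is positive because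
    \<open>d < sqrt 3 / 8\<close>, and \<open>2 ^ k * (d / 2)\<close> is the radius that
    \<open>ball_reduction\<close> produces for level \<open>Suc k\<close>.\<close>
  define P where "P k \<longleftrightarrow> sqrt 3 / 16 \<le> 2 ^ k * (d / 2)" for k :: nat
  obtain k0 where "sqrt 3 / 16 / (d / 2) < 2 ^ k0" using real_arch_pow[of 2 "sqrt 3 / 16 / (d / 2)"] by auto
  then have "P k0" using d by (simp add: P_def field_simps)
  then have P: "P (LEAST k. P k)" by (rule LeastI)
  define k where "k = (LEAST k. P k)"
  have "\<not> P 0" using d by (simp add: P_def)
  then obtain k' where k': "k = Suc k'" using P unfolding k_def by (cases "LEAST k. P k") auto
  have "\<not> P k'" using not_less_Least[of k' P] k' k_def by simp
  have "P (Suc k')" using P k' by (simp add: k_def)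
  define d' where "d' = 2 ^ Suc k / 4 * d"
  have d': "sqrt 3 / 16 \<le> d'" "d' < sqrt 3 / 8"
    using \<open>P (Suc k')\<close> \<open>\<not> P k'\<close> by (auto simp: P_def d'_def k' field_simps)
  have "d < sqrt 3 / 2 / 2 ^ Suc k" using d'(2) by (simp add: d'_def field_simps)
  from ball_reduction[OF M x this] obtain x' where x': "x' \<in> cell [0, 1]"
    "measure M (cball x d) \<le> 9 / 3 ^ Suc k * measure M (cball x' d')"
    unfolding d'_def by blast
  have "t * measure M (cball x d) \<le> 9 / 3 ^ Suc k * (t * measure M (cball x' d'))"
    using mult_left_mono[OF x'(2) t] by (simp add: mult_ac)
  also have "\<dots> \<le> 9 / 3 ^ Suc k * (2 * d') powr dim_S"
    by (intro mult_left_mono bound x' d') simp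
  also have "\<dots> = (2 * d) powr dim_S"
  proof -
    have "(2 * d) powr dim_S = (2 * d' * 4 / 2 ^ Suc k) powr dim_S"
      by (simp add: d'_def)
    also have "\<dots> = (2 * d' * 4) powr dim_S / 3 ^ Suc k"
      using d by (intro powr_dim_S_scale) (simp add: d'_def)
    also have "(2 * d' * 4) powr dim_S = 9 * (2 * d') powr dim_S"
    proof -
      have "(2 * d') powr dim_S = (2 * d' * 4 / 2 ^ 2) powr dim_S" by simp
      also have "\<dots> = (2 * d' * 4) powr dim_S / 3 ^ 2"
        using d by (intro powr_dim_S_scale) (simp add: d'_def)
      finally show ?thesis by simp
    qed
    finally show ?thesis by simp
  qed
  finally show ?thesis .
qed

text \<open>Mass distribution principle: the balls of a covering have total mass at least 1, and
  each mass is bounded by the cost. The gasket itself serves as the closed subset.\<close>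

lemma centred_Hausdorff_gasket_ge:
  assumes M: "self_similar M" and t: "0 \<le> t"
    and bound: "\<And>x d. x \<in> cell [0, 1] \<Longrightarrow> sqrt 3 / 16 \<le> d \<Longrightarrow> d < sqrt 3 / 8 \<Longrightarrow>
      t * measure M (cball x d) \<le> (2 * d) powr dim_S"
  shows "ennreal t \<le> centred_Hausdorff dim_S gasket"
proof -
  interpret prob_space M using M by (simp add: self_similar_def)
  have s: "sets M = sets borel" using M by (simp add: self_similar_def)
  have le: "ennreal t \<le> centred_premeasure_at dim_S \<delta> gasket" if \<delta>: "\<delta> < sqrt 3 / 8" for \<delta>
    unfolding centred_premeasure_at_def
  proof (rule Inf_greatest)
    fix c
    assume "c \<in> {(\<Sum>i. ennreal ((2 * d i) powr dim_S)) | (x :: nat \<Rightarrow> real^2) (d :: nat \<Rightarrow> real).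
            (\<forall>i. x i \<in> gasket \<and> 0 < d i \<and> 2 * d i \<le> \<delta>) \<and> gasket \<subseteq> (\<Union>i. cball (x i) (d i))}"
    then obtain x :: "nat \<Rightarrow> real^2" and d :: "nat \<Rightarrow> real" where
      c: "c = (\<Sum>i. ennreal ((2 * d i) powr dim_S))"
      and xd: "\<And>i. x i \<in> gasket" "\<And>i. 0 < d i" "\<And>i. 2 * d i \<le> \<delta>" and cov: "gasket \<subseteq> (\<Union>i. cball (x i) (d i))"
      by blast
    have small: "d i < sqrt 3 / 8" for i using xd(2,3)[of i] \<delta> by linarith
    have "1 = measure M (\<Union>i. cball (x i) (d i))"
      using cov by (intro self_similar_full[OF M, symmetric]) auto
    then have "ennreal t = ennreal t * emeasure M (\<Union>i. cball (x i) (d i))"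
      by (simp add: emeasure_eq_measure)
    also have "\<dots> \<le> ennreal t * (\<Sum>i. emeasure M (cball (x i) (d i)))"
      by (intro mult_left_mono emeasure_subadditive_countably) (auto simp: s)
    also have "\<dots> = (\<Sum>i. ennreal (t * measure M (cball (x i) (d i))))"
      using t by (simp add: emeasure_eq_measure ennreal_mult)
    also have "\<dots> \<le> c"
      unfolding c
      by (intro suminf_le allI ennreal_leI self_similar_ball_bound[OF M t bound] xd small) auto
    finally show "ennreal t \<le> c" .
  qed
  have "\<forall>\<^sub>F \<delta> in at_right (0::real). \<delta> < sqrt 3 / 8"
    unfolding eventually_at_right_field by (intro exI[of _ "sqrt 3 / 8"]) auto
  then have "\<forall>\<^sub>F \<delta> in at_right 0. ennreal t \<le> centred_premeasure_at dim_S \<delta> gasket"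
    by eventually_elim (rule le)
  then have "ennreal t \<le> centred_premeasure dim_S gasket"
    by (rule tendsto_lowerbound[OF centred_premeasure_at_tendsto[OF gasket_nonempty]]) simp
  also have "\<dots> \<le> centred_Hausdorff dim_S gasket"
    unfolding centred_Hausdorff_def by (rule Sup_upper) auto
  finally show ?thesis .
qed

section \<open>The discrete approximations and their edge graph\<close>

lemma A_approx_eq:
  "A_approx k = (\<Union>w\<in>words (k - 1). \<Union>i\<in>alphabet. {smap_word w (corner i)})"
proof -
  have "(gasket_step ^^ n) (corner ` alphabet) = (\<Union>w\<in>words n. \<Union>i\<in>alphabet. {smap_word w (corner i)})" for n
  proof (induction n)
    case (Suc n)
    have "(gasket_step ^^ Suc n) (corner ` alphabet)
        = gasket_step (\<Union>w\<in>words n. \<Union>i\<in>alphabet. {smap_word w (corner i)})"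
      unfolding Suc[symmetric] by simp
    also have "\<dots> = (\<Union>a\<in>alphabet. smap a ` (\<Union>w\<in>words n. \<Union>i\<in>alphabet. {smap_word w (corner i)}))"
      by (rule UN_gasket_step)
    also have "\<dots> = (\<Union>w\<in>words (Suc n). \<Union>i\<in>alphabet. {smap_word w (corner i)})"
      unfolding words_Suc by (auto simp: image_UN; blast)
    finally show ?case .
  qed auto
  then show ?thesis by (simp add: A_approx_def alphabet_def)
qed

lemma finite_A_approx: "finite (A_approx k)"
  by (simp add: A_approx_eq)

lemma A_approx_subset: "A_approx k \<subseteq> gasket"
  unfolding A_approx_eq using smap_word_in_gasket corner_in_gasket by blast

lemma corner_in_A_approx:
  assumes "i \<in> alphabet"
  shows "corner i \<in> A_approx k"
proof -
  have "smap_word (replicate n i) (corner i) = corner i" for n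
    by (induction n) (auto simp: corner_fixed)
  then have "corner i \<in> {smap_word (replicate (k - 1) i) (corner i)}" by simp
  moreover have "replicate (k - 1) i \<in> words (k - 1)"
    using assms by (auto simp: words_def)
  ultimately show ?thesis using assms unfolding A_approx_eq by blast
qed

text \<open>Connectedness of the edge graph: the pieces \<open>a\<close> and \<open>b\<close> share
  the vertex \<open>smap a (corner b) = smap b (corner a)\<close>, through which the value of
  \<open>Q\<close> is passed on.\<close>

lemma A_approx_connected:
  assumes "\<And>w i j. w \<in> words n \<Longrightarrow> i \<in> alphabet \<Longrightarrow> j \<in> alphabet \<Longrightarrow>
      Q (smap_word w (corner i)) = Q (smap_word w (corner j))"
    and "x \<in> A_approx (Suc n)" "y \<in> A_approx (Suc n)"
  shows "Q x = Q y"
  using assms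
proof (induction n arbitrary: Q x y)
  case 0
  then show ?case by (auto simp: A_approx_eq)
next
  case (Suc n)
  have step: "\<exists>a\<in>alphabet. \<exists>x'\<in>A_approx (Suc n). x = smap a x'" if "x \<in> A_approx (Suc (Suc n))" for x
    using that by (auto simp: A_approx_eq words_Suc)
  have IH: "Q (smap a x') = Q (smap a y')"
    if "a \<in> alphabet" "x' \<in> A_approx (Suc n)" "y' \<in> A_approx (Suc n)" for a x' y'
  proof (rule Suc.IH[of "\<lambda>z. Q (smap a z)", OF _ that(2,3)])
    fix w i j assume "w \<in> words n" "i \<in> alphabet" "j \<in> alphabet"
    moreover from this have "a # w \<in> words (Suc n)" using that(1) by (auto simp: words_def)
    ultimately show "Q (smap a (smap_word w (corner i))) = Q (smap a (smap_word w (corner j)))"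
      using Suc.prems(1)[of "a # w" i j] by simp
  qed
  obtain a x' where a: "a \<in> alphabet" "x' \<in> A_approx (Suc n)" "x = smap a x'"
    using step[OF Suc.prems(2)] by blast
  obtain b y' where b: "b \<in> alphabet" "y' \<in> A_approx (Suc n)" "y = smap b y'"
    using step[OF Suc.prems(3)] by blast
  have "Q x = Q (smap a (corner b))"
    using IH[OF a(1,2) corner_in_A_approx[OF b(1)]] a(3) by simp
  also have "\<dots> = Q (smap b (corner a))" by (simp add: smap_corner_commute)
  also have "\<dots> = Q y"
    using IH[OF b(1) corner_in_A_approx[OF a(1)] b(2)] b(3) by simp
  finally show ?case .
qed

lemma dist_corner_02: "dist (corner 0) (corner 2) = 1"
proof -
  have "(dist (corner 0) (corner 2))\<^sup>2 = 1"
    unfolding dist_bary sum_alphabet by (simp add: bary_corner)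
  then show ?thesis using zero_le_dist[of "corner 0" "corner 2"] by (auto simp: power2_eq_1_iff)
qed

text \<open>Moving along the edges of \<open>A_approx k\<close> from a point inside the ball to one outside, the
  distance to \<open>x\<close> grows by at most one edge length per step.\<close>

lemma A_approx_annulus:
  assumes k: "k \<ge> 1" and x: "x \<in> A_approx k" and d: "0 \<le> d" "d < 1 / 2"
  shows "\<exists>y\<in>A_approx k. d < dist x y \<and> dist x y \<le> d + 2 / 2 ^ k"
proof (rule ccontr)
  assume neg: "\<not> ?thesis"
  obtain n where n: "k = Suc n" using k by (cases k) auto
  \<comment> \<open>The points of \<open>A_approx k\<close> are corners of cells of level
    \<open>k - 1\<close>, hence \<open>2 / 2 ^ k\<close> and not \<open>1 / 2 ^ k\<close>.\<close>
  have edge: "dist (smap_word w (corner i)) (smap_word w (corner j)) \<le> 2 / 2 ^ k"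
    if "w \<in> words n" "i \<in> alphabet" "j \<in> alphabet" for w i j
    using dist_cell_le[OF corner_in_gasket[OF that(2)] corner_in_gasket[OF that(3)] that(1)]
    by (simp add: n)
  have step: "dist x (smap_word w (corner j)) \<le> d"
    if *: "w \<in> words n" "i \<in> alphabet" "j \<in> alphabet" "dist x (smap_word w (corner i)) \<le> d" for w i j
  proof -
    have "smap_word w (corner j) \<in> A_approx k" using * by (auto simp: A_approx_eq n)
    moreover have "dist x (smap_word w (corner j)) \<le> d + 2 / 2 ^ k"
      using edge[OF *(1-3)] *(4) dist_triangle[of x "smap_word w (corner j)" "smap_word w (corner i)"]
      by linarith
    ultimately show ?thesis using neg by force
  qed
  have all: "dist x y \<le> d" if "y \<in> A_approx k" for y
  proof -
    have "(dist x x \<le> d) = (dist x y \<le> d)"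
      by (rule A_approx_connected[of n "\<lambda>z. dist x z \<le> d"]) (use step x that n in blast)+
    then show ?thesis using d by simp
  qed
  have "dist (corner 0) (corner 2) \<le> dist x (corner 0) + dist x (corner 2)"
    by (rule dist_triangle3)
  also have "\<dots> \<le> d + d" by (intro add_mono all corner_in_A_approx) auto
  finally show False using d by (simp add: dist_corner_02)
qed

section \<open>Squeezing the discrete minima\<close>

definition approx_set :: "nat \<Rightarrow> real set" where
  "approx_set k = {inverse (theta (mu k) dim_S x d) | x d.
                x \<in> A_approx k \<inter> cell [0, 1] \<and> (\<exists>y\<in>A_approx k. d = norm (y - x)) \<and>
                sqrt 3 / 16 \<le> d \<and> d \<le> sqrt 3 / 8 + 2 powr (1 - real k)}"

lemma finite_approx_set: "finite (approx_set k)"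
proof (rule finite_subset)
  show "approx_set k \<subseteq> (\<lambda>(x, y). inverse (theta (mu k) dim_S x (norm (y - x)))) ` (A_approx k \<times> A_approx k)"
    unfolding approx_set_def by auto
qed (simp add: finite_A_approx)

lemma inverse_theta: "inverse (theta m s x d) = (2 * d) powr s / measure m (cball x d)"
  by (simp add: theta_def)

lemma two_powr_1_minus: "2 powr (1 - real k) = 2 / 2 ^ k"
  by (simp add: powr_diff powr_realpow)

text \<open>\<open>mu k\<close> of a ball is at most \<open>M\<close> of the ball enlarged by
  \<open>h = 1 / 2 ^ k\<close>, so only the factor \<open>(d / (d + h)) powr dim_S\<close> is lost.
  The bound \<open>sqrt 3 / 16 \<le> d\<close> makes this uniform and accounts for
  \<open>16 / sqrt 3\<close>.\<close>

lemma approx_set_ge: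
  assumes M: "self_similar M" and C: "0 \<le> C"
    "\<And>x d. x \<in> gasket \<Longrightarrow> 0 < d \<Longrightarrow> C \<le> (2 * d) powr dim_S / measure M (cball x d)"
    and k: "k \<ge> 1" and e: "e \<in> approx_set k"
  shows "C * (1 / (1 + 16 / sqrt 3 * (1 / 2 ^ k))) powr dim_S \<le> e"
proof -
  define h :: real where "h = 1 / 2 ^ k"
  have h: "h > 0" by (simp add: h_def)
  obtain x d where x: "x \<in> A_approx k" and d: "sqrt 3 / 16 \<le> d"
    and e: "e = (2 * d) powr dim_S / measure (mu k) (cball x d)"
    using e unfolding approx_set_def inverse_theta by blast
  have d0: "0 < d" using d by (rule less_le_trans[rotated]) simp
  have xg: "x \<in> gasket" using x A_approx_subset by blast
  let ?m = "measure (mu k) (cball x d)"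
  let ?M = "measure M (cball x (d + h))"
  have m_le: "?m \<le> ?M" unfolding h_def by (rule mu_le_self_similar[OF M k])
  obtain w i where w: "w \<in> words (k - 1)" "i \<in> alphabet" "x = smap_word w (corner i)"
    using x by (auto simp: A_approx_eq)
  \<comment> \<open>The centre is itself an atom, so no division by 0 occurs.\<close>
  have m_pos: "?m > 0"
  proof -
    have "(0::real) < (\<Sum>w\<in>words (k - 1). \<Sum>i\<in>alphabet. of_bool (smap_word w (corner i) \<in> cball x d))"
      using w d0 by (intro sum_pos2[of _ w] sum_pos2[of _ i] sum_nonneg) auto
    then show ?thesis by (simp add: measure_mu)
  qed
  have M_pos: "?M > 0" using m_pos m_le by linarith
  have ratio: "1 / (1 + 16 / sqrt 3 * h) \<le> d / (d + h)"
  proof -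
    have "h \<le> 16 / sqrt 3 * h * d" using d h by (simp add: field_simps)
    then have "d + h \<le> d * (1 + 16 / sqrt 3 * h)" by (simp add: algebra_simps)
    moreover have "0 < 1 + 16 / sqrt 3 * h" using h by (intro add_pos_pos mult_pos_pos) auto
    ultimately show ?thesis using d0 h by (simp add: divide_le_eq pos_le_divide_eq mult.commute)
  qed
  have "C * (1 / (1 + 16 / sqrt 3 * h)) powr dim_S \<le> C * (d / (d + h)) powr dim_S"
    using ratio C(1) h dim_S_pos by (intro mult_left_mono powr_mono2) auto
  also have "\<dots> = C * ((2 * d) powr dim_S / (2 * (d + h)) powr dim_S)"
    using d0 h powr_divide[of "2 * d" "2 * (d + h)" dim_S]
    by (simp only: mult_divide_mult_cancel_left[OF zero_neq_numeral[symmetric]])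
  also have "\<dots> \<le> (2 * (d + h)) powr dim_S / ?M * ((2 * d) powr dim_S / (2 * (d + h)) powr dim_S)"
    using C(2)[OF xg, of "d + h"] d0 h by (intro mult_right_mono) auto
  also have "\<dots> = (2 * d) powr dim_S / ?M" using d0 h by simp
  also have "\<dots> \<le> e" unfolding e using m_le m_pos M_pos by (intro divide_left_mono) auto
  finally show ?thesis by (simp add: h_def)
qed

text \<open>The centre moves to the atom of its level-\<open>k\<close> cell and the radius to a
  distance realised in \<open>A_approx k\<close>. The summand \<open>2 powr (1 - real k)\<close> in
  the range of radii is the room needed for this.\<close>

lemma approx_set_le:
  assumes M: "self_similar M" and k: "k \<ge> 4"
    and x: "x \<in> cell [0, 1]" and d: "sqrt 3 / 16 \<le> d" "d < sqrt 3 / 8"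
  shows "\<exists>e\<in>approx_set k. e \<le> (2 * (d + 2 / 2 ^ k)) powr dim_S / measure M (cball x d)"
proof -
  define h :: real where "h = 1 / 2 ^ k"
  have h: "h > 0" by (simp add: h_def)
  have d0: "0 < d" using d(1) by (rule less_le_trans[rotated]) simp
  obtain y where y: "y \<in> gasket" "x = smap_word [0, 1] y" using x by (auto simp: cell_def)
  obtain t z where t: "t \<in> words (k - 2)" "z \<in> gasket" "y = smap_word t z"
    using gasket_wordE[OF y(1)] .
  \<comment> \<open>The coding of the level-\<open>k\<close> cell of \<open>x\<close> begins with 0,
    1, and its last letter \<open>j\<close> selects the atom, which therefore stays in
    \<open>cell [0, 1]\<close>.\<close>
  have "k - 2 = Suc (k - 3)" using k by simp
  then obtain u j where u: "t = u @ [j]" "u \<in> words (k - 3)" "j \<in> alphabet"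
    using t(1) by (auto simp: words_snoc)
  define w where "w = [0, 1] @ u"
  have w: "w \<in> words (k - 1)"
    using words_append[of "[0, 1]" 2 u "k - 3"] u(2) k by (auto simp: w_def words_def)
  define xk where "xk = smap_word w (corner j)"
  have xkA: "xk \<in> A_approx k" using w u(3) by (auto simp: xk_def A_approx_eq)
  have xkc: "xk \<in> cell [0, 1]"
    using smap_word_in_gasket[OF u(2) corner_in_gasket[OF u(3)]]
    by (auto simp: xk_def w_def cell_def)
  have "x = smap_word (w @ [j]) z" by (simp add: y t u w_def smap_word_append)
  then have near: "dist x xk \<le> h"
    using dist_atom_le[OF w u(3) _ t(2)] k by (simp add: xk_def h_def)
  \<comment> \<open>One \<open>h\<close> pays for moving the centre, the other for passing from
    cells to atoms.\<close>
  define \<rho> where "\<rho> = d + 2 * h"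
  have "sqrt 3 < 2" by (rule real_less_lsqrt) auto
  then have "d < 1 / 2" using d by linarith
  then obtain y1 where y1: "y1 \<in> A_approx k" "d < dist xk y1" "dist xk y1 \<le> \<rho>"
    using A_approx_annulus[of k xk d] k xkA d0 by (auto simp: \<rho>_def h_def)
  define D where "D = {dist xk y | y. y \<in> A_approx k \<and> dist xk y \<le> \<rho>}"
  have D: "finite D" "D \<noteq> {}"
    using finite_A_approx y1 by (auto simp: D_def)
  \<comment> \<open>The largest realised distance up to \<open>\<rho>\<close>: shrinking the radius
    to it loses no atom, and by the annulus lemma it still exceeds \<open>d\<close>, hence the lower
    limit \<open>sqrt 3 / 16\<close>.\<close>
  define r where "r = Max D"
  have "r \<in> D" unfolding r_def by (rule Max_in[OF D])
  then obtain yk where yk: "yk \<in> A_approx k" "r = dist xk yk" "r \<le> \<rho>" by (auto simp: D_def)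
  have rge: "dist xk y \<le> r" if "y \<in> A_approx k" "dist xk y \<le> \<rho>" for y
    unfolding r_def using D(1) that by (intro Max_ge) (auto simp: D_def)
  have "d < r" using rge[OF y1(1,3)] y1(2) by linarith
  have in_set: "(2 * r) powr dim_S / measure (mu k) (cball xk r) \<in> approx_set k"
  proof -
    have "r = norm (yk - xk)" by (simp add: yk(2) dist_norm norm_minus_commute)
    moreover have "r \<le> sqrt 3 / 8 + 2 powr (1 - real k)"
      using yk(3) d(2) by (simp add: \<rho>_def h_def two_powr_1_minus)
    moreover have "sqrt 3 / 16 \<le> r" using \<open>d < r\<close> d by linarith
    ultimately show ?thesis
      unfolding approx_set_def inverse_theta using xkA xkc yk(1) by blast
  qed
  have M_pos: "measure M (cball x d) > 0"
    using x y smap_word_in_gasket[of "[0, 1]" 2 y] d0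
    by (intro self_similar_cball_pos[OF M]) (auto simp: words_def)
  have "measure M (cball x d) \<le> measure M (cball xk (d + h))"
  proof -
    have "cball x d \<subseteq> cball xk (d + h)"
    proof
      fix y assume "y \<in> cball x d"
      then have "dist xk y \<le> d + h"
        using near dist_triangle[of xk y x] by (simp add: dist_commute)
      then show "y \<in> cball xk (d + h)" by simp
    qed
    then show ?thesis
      using M by (intro finite_measure.finite_measure_mono) (auto simp: self_similar_def prob_space_def)
  qed
  also have "\<dots> \<le> measure (mu k) (cball xk \<rho>)"
    using self_similar_le_mu[OF M, of k xk "d + h"] k by (simp add: \<rho>_def h_def add.assoc)
  also have "\<dots> \<le> measure (mu k) (cball xk r)"
  proof -
    have "of_bool (smap_word w (corner i) \<in> cball xk \<rho>) \<le> (of_bool (smap_word w (corner i) \<in> cball xk r) :: real)"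
      if "w \<in> words (k - 1)" "i \<in> alphabet" for w i
      using rge[of "smap_word w (corner i)"] that by (auto simp: A_approx_eq)
    then show ?thesis
      by (subst (1 2) measure_mu) (simp, simp, intro divide_right_mono sum_mono, auto)
  qed
  finally have le: "measure M (cball x d) \<le> measure (mu k) (cball xk r)" .
  have "(2 * r) powr dim_S / measure (mu k) (cball xk r) \<le> (2 * \<rho>) powr dim_S / measure M (cball x d)"
    using le M_pos yk(3) \<open>d < r\<close> d0 dim_S_pos by (intro frac_le powr_mono2) auto
  then show ?thesis using in_set by (auto simp: \<rho>_def h_def)
qed

text \<open>Guarantees that \<open>Min\<close> of this set is one of its members.\<close>

lemma approx_set_nonempty:
  assumes "self_similar M" "k \<ge> 4"
  shows "approx_set k \<noteq> {}"
proof -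
  have "smap_word [0, 1] (corner 0) \<in> cell [0, 1]" by (auto simp: cell_def)
  from approx_set_le[OF assms this, of "sqrt 3 / 16"] show ?thesis by auto
qed

theorem mainTheorem3:
  shows "centred_Hausdorff dim_S gasket < \<infinity> \<and>
         C_approx \<longlonglongrightarrow> enn2real (centred_Hausdorff dim_S gasket)"
proof -
  obtain M where M: "self_similar M" using self_similar_exists by blast
  define H where "H = centred_Hausdorff dim_S gasket"
  define C where "C = enn2real H"
  have upper: "H \<le> ennreal ((2 * d) powr dim_S / measure M (cball x d))" if "x \<in> gasket" "0 < d" for x d
    unfolding H_def by (rule centred_Hausdorff_gasket_le[OF M that])
  \<comment> \<open>A single ball gives finiteness; for infinite \<open>H\<close> the value
    \<open>enn2real H\<close> would default to 0.\<close>
  have "H \<le> ennreal ((2 * 1) powr dim_S / measure M (cball (corner 0) 1))"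
    by (rule upper) auto
  then have fin: "H < \<infinity>" by (rule le_less_trans) simp
  then have H: "H = ennreal C" by (simp add: C_def)
  have C0: "0 \<le> C" by (simp add: C_def)
  have C_le: "C \<le> (2 * d) powr dim_S / measure M (cball x d)" if "x \<in> gasket" "0 < d" for x d
    using upper[OF that] unfolding H by (subst (asm) ennreal_le_iff) auto
  have C_approx: "C_approx k = Min (approx_set k)" for k
    by (simp add: C_approx_def approx_set_def)
  have "C_approx \<longlonglongrightarrow> C"
  proof (rule order_tendstoI)
    fix a assume a: "a < C"
    \<comment> \<open>The factor lost in \<open>approx_set_ge\<close> tends to 1.\<close>
    have "(\<lambda>k. C * (1 / (1 + 16 / sqrt 3 * (1 / 2 ^ k))) powr dim_S)
        \<longlonglongrightarrow> C * (1 / (1 + 16 / sqrt 3 * 0)) powr dim_S"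
      by (intro tendsto_intros LIMSEQ_divide_realpow_zero) auto
    then have "(\<lambda>k. C * (1 / (1 + 16 / sqrt 3 * (1 / 2 ^ k))) powr dim_S) \<longlonglongrightarrow> C" by simp
    from order_tendstoD(1)[OF this a] eventually_ge_at_top[of 4]
    show "\<forall>\<^sub>F k in sequentially. a < C_approx k"
    proof eventually_elim
      case (elim k)
      have "Min (approx_set k) \<in> approx_set k"
        by (rule Min_in[OF finite_approx_set approx_set_nonempty[OF M elim(2)]])
      from approx_set_ge[OF M C0 C_le _ this] elim show ?case by (simp add: C_approx)
    qed
  next
    fix a assume a: "C < a"
    \<comment> \<open>Otherwise \<open>a\<close> would satisfy the hypothesis of
      \<open>centred_Hausdorff_gasket_ge\<close>, giving \<open>ennreal a \<le> H\<close> against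
      \<open>C < a\<close>.\<close>
    have "\<exists>x d. x \<in> cell [0, 1] \<and> sqrt 3 / 16 \<le> d \<and> d < sqrt 3 / 8 \<and>
        (2 * d) powr dim_S < a * measure M (cball x d)"
    proof (rule ccontr)
      assume "\<not> ?thesis"
      then have "a * measure M (cball x d) \<le> (2 * d) powr dim_S"
        if "x \<in> cell [0, 1]" "sqrt 3 / 16 \<le> d" "d < sqrt 3 / 8" for x d
        using that by (meson not_less)
      then have "ennreal a \<le> H"
        unfolding H_def using a C0 by (intro centred_Hausdorff_gasket_ge[OF M]) linarith+
      then show False using a C0 unfolding H by (simp add: ennreal_le_iff)
    qed
    then obtain x d where x: "x \<in> cell [0, 1]" and d: "sqrt 3 / 16 \<le> d" "d < sqrt 3 / 8"
      and lt: "(2 * d) powr dim_S < a * measure M (cball x d)" by blast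
    have d0: "0 < d" using d(1) by (rule less_le_trans[rotated]) simp
    have "0 < a * measure M (cball x d)"
      using lt by (rule le_less_trans[rotated]) simp
    then have pos: "0 < measure M (cball x d)" by (simp add: zero_less_mult_iff)
    \<comment> \<open>The ball is fixed while \<open>k\<close> grows, so the bound from
      \<open>approx_set_le\<close> tends to a value below \<open>a\<close>.\<close>
    have "(\<lambda>k. (2 * (d + 2 / 2 ^ k)) powr dim_S / measure M (cball x d))
        \<longlonglongrightarrow> (2 * (d + 0)) powr dim_S / measure M (cball x d)"
      using d0 pos by (intro tendsto_intros LIMSEQ_divide_realpow_zero) auto
    moreover have "(2 * (d + 0)) powr dim_S / measure M (cball x d) < a"
      using lt pos by (simp add: divide_less_eq)
    ultimately have "\<forall>\<^sub>F k in sequentially. (2 * (d + 2 / 2 ^ k)) powr dim_S / measure M (cball x d) < a"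
      by (rule order_tendstoD(2))
    then show "\<forall>\<^sub>F k in sequentially. C_approx k < a"
      using eventually_ge_at_top[of 4]
    proof eventually_elim
      case (elim k)
      obtain e where "e \<in> approx_set k" "e \<le> (2 * (d + 2 / 2 ^ k)) powr dim_S / measure M (cball x d)"
        using approx_set_le[OF M elim(2) x d] by blast
      with elim(1) show ?case
        unfolding C_approx using Min_le[OF finite_approx_set, of e k] by linarith
    qed
  qed
  then show ?thesis using fin by (simp add: H_def C_def)
qed

end
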